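(* Consider the Funk geometry of the simplex $\Delta_n\subset\mathbb{R}^n$ with vertices $0,e_1,\dots,e_n$. The Holmes--Thompson volume of the forward ball $\Delta_n(R)$ of radius $R>0$ centered at the barycenter is $1/\omega_n$ times $$V_{\Delta_n}(R)=\frac{n+1}{n!}\int_{\Delta_n(R)}\frac{dx_1\cdots dx_n}{x_1\cdots x_n}.$$ For $n\ge2$ the following recursive formula holds: $$V'_{\Delta_n}(R)=\frac{n+1}{n}\cdot\frac{1}{1-\frac{e^{-R}}{n+1}}\;V_{\Delta_{n-1}}\Big(R+\log\Big(1+\frac1n-\frac1n e^{-R}\Big)\Big).$$ For all $n\ge1$, as $R\to\infty$, $$V_{\Delta_n}(R)=\frac{(n+1)!}{(n!)^2}R^n\big(1+n\log(n+1)R^{-1}+o(R^{-1})\big),$$ while, as $R\to0$, $$V_{\Delta_n}(R)=\frac{(n+1)^{n+1}}{(n!)^2}\Big(R^n-\frac n2R^{n+1}+o(R^{n+1})\Big).$$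
   Context: For a convex body $K\subset\mathbb{R}^n$ (compact, convex, nonempty interior) and $x\in\operatorname{int}K$, let $K^x:=(K-x)^\circ=\{\xi:\langle\xi,y-x\rangle\le 1\ \text{for all } y\in K\}$. The forward Funk metric ball of radius $R>0$ centered at $x\in\operatorname{int}K$ is $B_K(x,R):=x+(1-e^{-R})(K-x)$. The Holmes--Thompson volume of the Funk geometry on $K$ is $\operatorname{Vol}_K(U):=\frac{1}{\omega_n}\int_U|K^x|\,dx$ for Borel $U\subset\operatorname{int}K$, where $|\cdot|$ is Lebesgue measure and $\omega_n$ is the volume of the Euclidean unit ball in $\mathbb{R}^n$. Here $e_1,\dots,e_n$ is the standard basis of $\mathbb{R}^n$, the barycenter of $\Delta_n$ is $b=\frac1{n+1}(1,\dots,1)$, and $\Delta_n(R):=B_{\Delta_n}(b,R)=b+(1-e^{-R})(\Delta_n-b)$. *)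

theory Defs
  imports "HOL-Analysis.Analysis" "HOL-Library.Landau_Symbols"
begin

text \<open>The polar body \<open>K\<^sup>x = (K - x)\<degree>\<close>.\<close>
definition polar_at :: "'a::euclidean_space set \<Rightarrow> 'a \<Rightarrow> 'a set" where
  "polar_at K x = {\<xi>. \<forall>y\<in>K. \<xi> \<bullet> (y - x) \<le> 1}"

definition funk_ball :: "'a::euclidean_space set \<Rightarrow> 'a \<Rightarrow> real \<Rightarrow> 'a set" where
  "funk_ball K x R = (\<lambda>y. x + (1 - exp (- R)) *\<^sub>R (y - x)) ` K"

text \<open>The volume takes values in \<^typ>\<open>ennreal\<close>, so that an equation
  \<open>holmes_thompson K U = ennreal v\<close> includes the finiteness of the volume.
  The definition is meant for Borel sets \<open>U \<subseteq> interior K\<close>.\<close>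
definition holmes_thompson :: "'a::euclidean_space set \<Rightarrow> 'a set \<Rightarrow> ennreal" where
  "holmes_thompson K U =
     (\<integral>\<^sup>+x\<in>U. emeasure lborel (polar_at K x) \<partial>lborel) / emeasure lborel (ball (0::'a) 1)"

text \<open>The dimension \<open>n\<close> is \<^term>\<open>CARD('n)\<close>, and \<^const>\<open>Basis\<close> consists of the vectors
  \<open>axis i 1\<close>, that is, \<open>e\<^sub>1, \<dots>, e\<^sub>n\<close>.\<close>
definition std_simplex :: "(real ^ 'n) set" where
  "std_simplex = convex hull (insert 0 Basis)"

definition simplex_barycenter :: "real ^ 'n" where
  "simplex_barycenter = (\<chi> i. 1 / (real CARD('n) + 1))"

definition simplex_ball :: "real \<Rightarrow> (real ^ 'n) set" where
  "simplex_ball R = funk_ball std_simplex simplex_barycenter R"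

text \<open>The argument of type \<^typ>\<open>'n itself\<close> only records the dimension:
  \<open>simplex_V TYPE('n)\<close> is \<open>V\<close> of the simplex in \<open>\<real>\<^sup>n\<close> for \<open>n = CARD('n)\<close>.\<close>
definition simplex_V :: "'n::finite itself \<Rightarrow> real \<Rightarrow> real" where
  "simplex_V _ R = (real CARD('n) + 1) / fact CARD('n) *
     (LINT x:(simplex_ball R :: (real ^ 'n) set)|lborel. 1 / (\<Prod>i\<in>UNIV. x $ i))"

end

theory Submission imports Defs begin

text \<open>
  Put \<open>a = e\<^sup>-\<^sup>R / (n + 1)\<close>. In barycentric coordinates \<open>x\<^sub>0 = 1 - x\<^sub>1 - \<dots> - x\<^sub>n, x\<^sub>1, \<dots>, x\<^sub>n\<close>
  the forward ball is the truncated simplex on which all coordinates are at least \<open>a\<close>. Hence \<open>V\<close> is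
  governed by the integral of \<open>1 / (x\<^sub>1 \<dots> x\<^sub>n)\<close> over \<open>{x\<^sub>i \<ge> a, x\<^sub>1 + \<dots> + x\<^sub>n \<le> 1 - a}\<close>. By
  homogeneity it depends only on \<open>u = (1 - a) / a = (n + 1) e\<^sup>R - 1\<close>; call it \<open>H\<^sub>n(u)\<close>.

  The recursion comes from the identity \<open>1 = \<Sum>\<^sub>j x\<^sub>j / (x\<^sub>1 + \<dots> + x\<^sub>n)\<close> under the integral. In the
  \<open>j\<close>-th summand the factor \<open>x\<^sub>j\<close> cancels against \<open>1 / x\<^sub>j\<close>, so that the total
  \<open>w = x\<^sub>1 + \<dots> + x\<^sub>n\<close> can replace \<open>x\<^sub>j\<close> as a coordinate, and Fubini gives
  \<open>H\<^sub>n(u) = n \<integral>\<^bsub>n\<^esub>\<^bsup>u\<^esup> H\<^bsub>n-1\<^esub>(w - 1) / w dw\<close> (lemmas \<open>nn_integral_size_biased\<close>,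
  \<open>cut_integral_recursion\<close>, \<open>cut_integral_eq_cut_fun\<close>). With \<open>H\<^sub>n' (u) = n H\<^bsub>n-1\<^esub>(u - 1) / u\<close> the
  formula for \<open>V'\<close> is the chain rule, since the shift
  \<open>S = R + ln (1 + 1/n - e\<^sup>-\<^sup>R / n)\<close> is the solution of \<open>n e\<^sup>S - 1 = u - 1\<close>.

  Both asymptotic expansions follow by induction on \<open>n\<close> with l'Hopital's rule, as the derivative
  of \<open>H\<^sub>n\<close> is expressed through \<open>H\<^bsub>n-1\<^esub>\<close>: one has \<open>H\<^sub>n(u) = ln\<^sup>n u + o(ln\<^sup>n\<^sup>-\<^sup>1 u)\<close> at infinity
  (\<open>cut_fun_at_top\<close>) and \<open>H\<^sub>n(n + h) = h\<^sup>n / n! - n h\<^sup>n\<^sup>+\<^sup>1 / (n + 1)! + o(h\<^sup>n\<^sup>+\<^sup>1)\<close> at the left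
  end point (\<open>cut_fun_at_right\<close>). Substituting \<open>u = (n + 1) e\<^sup>R - 1\<close> yields those of \<open>V\<close>.

  For the Holmes--Thompson volume, the polar body of the simplex at \<open>x\<close> is itself a simplex, of
  volume \<open>1 / (n! x\<^sub>0 x\<^sub>1 \<dots> x\<^sub>n)\<close> (\<open>emeasure_polar_at_std_simplex\<close>). As the barycentric coordinates
  add up to \<open>1\<close>, one has \<open>1 / (x\<^sub>0 \<dots> x\<^sub>n) = \<Sum>\<^sub>j x\<^sub>j / (x\<^sub>0 \<dots> x\<^sub>n)\<close>, and by the symmetry of the ball in
  these coordinates all \<open>n + 1\<close> summands have the same integral \<open>H\<^sub>n(u)\<close>
  (\<open>nn_integral_last_coordinate\<close>). This is the factor \<open>n + 1\<close>.
\<close>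

section \<open>The integral of the reciprocal product over a truncated simplex\<close>

text \<open>
  The constraints \<open>x\<^sub>i \<ge> a\<close> are encoded in the factors of the integrand, so that the integral
  over the truncated simplex lives on a product measure and coordinates can be split off.
\<close>

definition trunc_recip :: "real \<Rightarrow> real \<Rightarrow> real" where
  "trunc_recip a s = (if a \<le> s then 1 / s else 0)"

text \<open>
  For \<open>a > 0\<close> this is the integral of \<open>\<Prod>\<^sub>i 1 / x\<^sub>i\<close> over the points of \<open>\<real>\<^sup>I\<close> with all coordinates at
  least \<open>a\<close> and coordinate sum at most \<open>t\<close>. An arbitrary index set \<open>I\<close> permits induction on the
  dimension.
\<close>

definition cut_integral :: "'i set \<Rightarrow> real \<Rightarrow> real \<Rightarrow> ennreal" where
  "cut_integral I a t =
     (\<integral>\<^sup>+x. ennreal (\<Prod>i\<in>I. trunc_recip a (x i)) * indicator {..t} (\<Sum>i\<in>I. x i) \<partial>(\<Pi>\<^sub>M i\<in>I. lborel))"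

lemma trunc_recip_measurable [measurable]: "trunc_recip a \<in> borel_measurable borel"
  unfolding trunc_recip_def by measurable

lemma trunc_recip_nonneg: "a > 0 \<Longrightarrow> trunc_recip a s \<ge> 0"
  by (simp add: trunc_recip_def)

lemma product_sigma_finite_lborel: "product_sigma_finite (\<lambda>_. lborel :: real measure)"
  by (simp add: product_sigma_finite_def sigma_finite_lborel)

lemma cut_integral_measurable [measurable]:
  assumes "finite I"
  shows "cut_integral I a \<in> borel_measurable borel"
proof -
  interpret finite_product_sigma_finite "\<lambda>_. lborel :: real measure" I
    by (simp add: finite_product_sigma_finite_def product_sigma_finite_lborel
        finite_product_sigma_finite_axioms_def assms)
  show ?thesis
    unfolding cut_integral_def indicator_def atMost_iff
    by (rule borel_measurable_nn_integral) measurable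
qed

text \<open>
  The weight \<open>x\<^sub>j\<close> turns \<open>dx\<^sub>j / x\<^sub>j\<close> into Lebesgue measure, which is invariant under
  translations. Therefore the sum \<open>w\<close> of all coordinates can serve as the integration variable in
  place of \<open>x\<^sub>j\<close>, the constraint \<open>x\<^sub>j \<ge> a\<close> becomes a bound \<open>w - a\<close> on the sum of the other
  coordinates, and Fubini separates \<open>w\<close> from them.
\<close>

lemma nn_integral_size_biased:
  fixes \<phi> :: "real \<Rightarrow> ennreal"
  assumes I: "finite I" "j \<in> I" and a: "a > 0" and [measurable]: "\<phi> \<in> borel_measurable borel"
  shows "(\<integral>\<^sup>+x. ennreal (x j) * \<phi> (\<Sum>i\<in>I. x i) * ennreal (\<Prod>i\<in>I. trunc_recip a (x i)) \<partial>(\<Pi>\<^sub>M i\<in>I. lborel))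
       = (\<integral>\<^sup>+w. \<phi> w * cut_integral (I - {j}) a (w - a) \<partial>lborel)"
proof -
  interpret product_sigma_finite "\<lambda>_. lborel :: real measure"
    by (rule product_sigma_finite_lborel)
  define J where "J = I - {j}"
  have J: "finite J" "j \<notin> J" "I = insert j J" using I by (auto simp: J_def)
  interpret J: finite_product_sigma_finite "\<lambda>_. lborel :: real measure" J
    by standard (rule J)
  interpret P: pair_sigma_finite "\<Pi>\<^sub>M i\<in>J. lborel :: real measure" "lborel :: real measure"
    by (simp add: pair_sigma_finite_def J.sigma_finite_measure_axioms sigma_finite_lborel)
  let ?g = "\<lambda>y. ennreal (\<Prod>i\<in>J. trunc_recip a (y i))"
  have "(\<integral>\<^sup>+x. ennreal (x j) * \<phi> (\<Sum>i\<in>I. x i) * ennreal (\<Prod>i\<in>I. trunc_recip a (x i)) \<partial>(\<Pi>\<^sub>M i\<in>I. lborel))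
     = (\<integral>\<^sup>+y. \<integral>\<^sup>+s. ennreal s * \<phi> (s + (\<Sum>i\<in>J. y i)) * ennreal (trunc_recip a s * (\<Prod>i\<in>J. trunc_recip a (y i)))
          \<partial>lborel \<partial>(\<Pi>\<^sub>M i\<in>J. lborel))"
    unfolding J(3)
  proof (subst product_nn_integral_insert[OF J(1,2)], goal_cases)
    case 2
    have "(\<Sum>i\<in>J. (y(j := s)) i) = (\<Sum>i\<in>J. y i)" 
      "(\<Prod>i\<in>J. trunc_recip a ((y(j := s)) i)) = (\<Prod>i\<in>J. trunc_recip a (y i))" for y s
      using J(2) by (auto intro!: sum.cong prod.cong)
    then show ?case using J by simp
  qed measurable
  also have "\<dots> = (\<integral>\<^sup>+y. \<integral>\<^sup>+s. \<phi> (s + (\<Sum>i\<in>J. y i)) * indicator {a..} s * ?g y \<partial>lborel \<partial>(\<Pi>\<^sub>M i\<in>J. lborel))"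
  proof (intro nn_integral_cong)
    fix y s
    have "ennreal s * ennreal (trunc_recip a s * (\<Prod>i\<in>J. trunc_recip a (y i))) = indicator {a..} s * ?g y"
      using a by (auto simp: trunc_recip_def indicator_def ennreal_mult'[symmetric])
    then show "ennreal s * \<phi> (s + (\<Sum>i\<in>J. y i)) * ennreal (trunc_recip a s * (\<Prod>i\<in>J. trunc_recip a (y i)))
        = \<phi> (s + (\<Sum>i\<in>J. y i)) * indicator {a..} s * ?g y"
      by (metis (no_types, lifting) mult.assoc mult.commute)
  qed
  also have "\<dots> = (\<integral>\<^sup>+y. \<integral>\<^sup>+w. \<phi> w * indicator {a..} (w - (\<Sum>i\<in>J. y i)) * ?g y \<partial>lborel \<partial>(\<Pi>\<^sub>M i\<in>J. lborel))"
  proof (rule nn_integral_cong, goal_cases)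
    case (1 y)
    show ?case
      by (subst (2) nn_integral_real_affine[where c=1 and t="\<Sum>i\<in>J. y i"]) (auto simp: add.commute)
  qed
  also have "\<dots> = (\<integral>\<^sup>+w. \<integral>\<^sup>+y. \<phi> w * indicator {a..} (w - (\<Sum>i\<in>J. y i)) * ?g y \<partial>(\<Pi>\<^sub>M i\<in>J. lborel) \<partial>lborel)"
    by (intro P.Fubini'[symmetric]) measurable
  also have "\<dots> = (\<integral>\<^sup>+w. \<phi> w * cut_integral J a (w - a) \<partial>lborel)"
  proof (intro nn_integral_cong, goal_cases)
    case (1 w)
    have "\<phi> w * cut_integral J a (w - a) =
       (\<integral>\<^sup>+y. \<phi> w * (?g y * indicator {..w - a} (\<Sum>i\<in>J. y i)) \<partial>(\<Pi>\<^sub>M i\<in>J. lborel))"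
      unfolding cut_integral_def by (intro nn_integral_cmult[symmetric]) measurable
    also have "\<dots> = (\<integral>\<^sup>+y. \<phi> w * indicator {a..} (w - (\<Sum>i\<in>J. y i)) * ?g y \<partial>(\<Pi>\<^sub>M i\<in>J. lborel))"
      by (intro nn_integral_cong) (auto simp: indicator_def algebra_simps)
    finally show ?case ..
  qed
  finally show ?thesis by (simp add: J_def)
qed

lemma cut_integral_remove:
  assumes I: "finite I" "j \<in> I" and a: "a > 0"
  shows "cut_integral I a t = (\<integral>\<^sup>+s. ennreal (trunc_recip a s) * cut_integral (I - {j}) a (t - s) \<partial>lborel)"
proof -
  interpret product_sigma_finite "\<lambda>_. lborel :: real measure"
    by (rule product_sigma_finite_lborel)
  define J where "J = I - {j}"
  have J: "finite J" "j \<notin> J" "I = insert j J" using I by (auto simp: J_def)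
  have "cut_integral I a t = (\<integral>\<^sup>+s. \<integral>\<^sup>+y. ennreal (trunc_recip a s * (\<Prod>i\<in>J. trunc_recip a (y i)))
      * indicator {..t} (s + (\<Sum>i\<in>J. y i)) \<partial>(\<Pi>\<^sub>M i\<in>J. lborel) \<partial>lborel)"
    unfolding J(3) cut_integral_def
  proof (subst product_nn_integral_insert_rev[OF J(1,2)], goal_cases)
    case 2
    have "(\<Sum>i\<in>J. (y(j := s)) i) = (\<Sum>i\<in>J. y i)" 
      "(\<Prod>i\<in>J. trunc_recip a ((y(j := s)) i)) = (\<Prod>i\<in>J. trunc_recip a (y i))" for y s
      using J(2) by (auto intro!: sum.cong prod.cong)
    then show ?case using J by simp
  qed measurable
  also have "\<dots> = (\<integral>\<^sup>+s. ennreal (trunc_recip a s) * cut_integral J a (t - s) \<partial>lborel)"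
  proof (intro nn_integral_cong, goal_cases)
    case (1 s)
    have "ennreal (trunc_recip a s) * cut_integral J a (t - s) =
       (\<integral>\<^sup>+y. ennreal (trunc_recip a s) * (ennreal (\<Prod>i\<in>J. trunc_recip a (y i)) * indicator {..t - s} (\<Sum>i\<in>J. y i)) \<partial>(\<Pi>\<^sub>M i\<in>J. lborel))"
      unfolding cut_integral_def by (intro nn_integral_cmult[symmetric]) measurable
    also have "\<dots> = (\<integral>\<^sup>+y. ennreal (trunc_recip a s * (\<Prod>i\<in>J. trunc_recip a (y i)))
      * indicator {..t} (s + (\<Sum>i\<in>J. y i)) \<partial>(\<Pi>\<^sub>M i\<in>J. lborel))"
      by (intro nn_integral_cong) (auto simp: indicator_def algebra_simps trunc_recip_nonneg[OF a] ennreal_mult')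
    finally show ?case ..
  qed
  finally show ?thesis by (simp add: J_def)
qed

lemma prod_trunc_recip_eq_0:
  assumes "finite I" "i \<in> I" "x i < a"
  shows "(\<Prod>i\<in>I. trunc_recip a (x i)) = 0"
  using assms by (intro prod_zero) (auto simp: trunc_recip_def intro!: bexI[of _ i])

text \<open>
  On the truncated simplex the sum of the coordinates is positive, so \<open>1\<close> splits into the
  fractions \<open>x\<^sub>j / (\<Sum>\<^sub>i x\<^sub>i)\<close>, and each of them is a case of
  \<open>nn_integral_size_biased\<close>.
\<close>

lemma cut_integral_recursion:
  assumes I: "finite I" "I \<noteq> {}" and a: "a > 0"
  shows "cut_integral I a t =
    (\<Sum>j\<in>I. \<integral>\<^sup>+w. ennreal (1 / w) * indicator {..t} w * cut_integral (I - {j}) a (w - a) \<partial>lborel)"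
proof -
  have "cut_integral I a t = (\<integral>\<^sup>+x. (\<Sum>j\<in>I. ennreal (x j) * (ennreal (1 / (\<Sum>i\<in>I. x i)) * indicator {..t} (\<Sum>i\<in>I. x i))
      * ennreal (\<Prod>i\<in>I. trunc_recip a (x i))) \<partial>(\<Pi>\<^sub>M i\<in>I. lborel))"
    unfolding cut_integral_def
  proof (intro nn_integral_cong, goal_cases)
    case (1 x)
    show ?case
    proof (cases "\<forall>i\<in>I. a \<le> x i")
      case True
      have p: "0 < x i" if "i \<in> I" for i using True a that by force
      have S: "(\<Sum>i\<in>I. x i) > 0" using I p by (intro sum_pos) auto
      have "(\<Sum>j\<in>I. ennreal (x j) * (ennreal (1 / (\<Sum>i\<in>I. x i)) * indicator {..t} (\<Sum>i\<in>I. x i))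
          * ennreal (\<Prod>i\<in>I. trunc_recip a (x i))) = 
          ennreal (\<Sum>i\<in>I. x i) * ennreal (1 / (\<Sum>i\<in>I. x i)) * (indicator {..t} (\<Sum>i\<in>I. x i)
          * ennreal (\<Prod>i\<in>I. trunc_recip a (x i)))"
        using p by (simp add: sum_distrib_right[symmetric] mult.assoc sum_ennreal less_imp_le)
      also have "ennreal (\<Sum>i\<in>I. x i) * ennreal (1 / (\<Sum>i\<in>I. x i)) = 1"
        using S by (simp add: ennreal_mult'[symmetric])
      finally show ?thesis by (simp add: mult_ac)
    next
      case False
      then show ?thesis using prod_trunc_recip_eq_0[OF I(1), of _ x a] by (auto simp: not_le)
    qed
  qed
  also have "\<dots> = (\<Sum>j\<in>I. \<integral>\<^sup>+x. ennreal (x j) * (ennreal (1 / (\<Sum>i\<in>I. x i)) * indicator {..t} (\<Sum>i\<in>I. x i))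
      * ennreal (\<Prod>i\<in>I. trunc_recip a (x i)) \<partial>(\<Pi>\<^sub>M i\<in>I. lborel))"
    by (intro nn_integral_sum) measurable
  also have "\<dots> = (\<Sum>j\<in>I. \<integral>\<^sup>+w. ennreal (1 / w) * indicator {..t} w * cut_integral (I - {j}) a (w - a) \<partial>lborel)"
    by (intro sum.cong refl nn_integral_size_biased I a) measurable
  finally show ?thesis .
qed

text \<open>
  With \<open>S\<close> the sum of the coordinates and \<open>1 - S\<close> the missing barycentric coordinate, one has
  \<open>1 / (1 - S) = 1 + \<Sum>\<^sub>j x\<^sub>j / (1 - S)\<close>. The \<open>j\<close>-th summand is again
  \<open>nn_integral_size_biased\<close>; the reflection \<open>s = 1 - w\<close> exchanges \<open>x\<^sub>j\<close> with the missing
  coordinate and turns the result into \<open>cut_integral_remove\<close>. This is the symmetry of the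
  simplex under permutations of all its vertices.
\<close>

lemma nn_integral_last_coordinate:
  assumes I: "finite I" and a: "a > 0"
  shows "(\<integral>\<^sup>+x. ennreal (1 / (1 - (\<Sum>i\<in>I. x i))) * (ennreal (\<Prod>i\<in>I. trunc_recip a (x i)) * indicator {..1 - a} (\<Sum>i\<in>I. x i))
      \<partial>(\<Pi>\<^sub>M i\<in>I. lborel)) = of_nat (card I + 1) * cut_integral I a (1 - a)"
proof -
  let ?\<phi> = "\<lambda>w. ennreal (1 / (1 - w)) * indicator {..1 - a} w"
  let ?P = "\<lambda>x. ennreal (\<Prod>i\<in>I. trunc_recip a (x i))"
  have "(\<integral>\<^sup>+x. ennreal (1 / (1 - (\<Sum>i\<in>I. x i))) * (?P x * indicator {..1 - a} (\<Sum>i\<in>I. x i)) \<partial>(\<Pi>\<^sub>M i\<in>I. lborel))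
    = (\<integral>\<^sup>+x. ?P x * indicator {..1 - a} (\<Sum>i\<in>I. x i) +
         (\<Sum>j\<in>I. ennreal (x j) * ?\<phi> (\<Sum>i\<in>I. x i) * ?P x) \<partial>(\<Pi>\<^sub>M i\<in>I. lborel))"
  proof (intro nn_integral_cong, goal_cases)
    case (1 x)
    show ?case
    proof (cases "(\<forall>i\<in>I. a \<le> x i) \<and> (\<Sum>i\<in>I. x i) \<le> 1 - a")
      case True
      have p: "0 \<le> x i" if "i \<in> I" for i using True a that by force
      define S where "S = (\<Sum>i\<in>I. x i)"
      have S: "0 \<le> S" "S < 1" using p True a by (auto simp: S_def sum_nonneg)
      have "(\<Sum>j\<in>I. ennreal (x j) * ennreal (1 / (1 - S)) * ?P x) = ennreal S * ennreal (1 / (1 - S)) * ?P x"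
        using p by (simp add: sum_distrib_right[symmetric] mult.assoc sum_ennreal S_def)
      then have "?P x + (\<Sum>j\<in>I. ennreal (x j) * ennreal (1 / (1 - S)) * ?P x) = (1 + ennreal S * ennreal (1 / (1 - S))) * ?P x"
        by (simp add: distrib_right)
      also have "1 + ennreal S * ennreal (1 / (1 - S)) = ennreal (1 + S * (1 / (1 - S)))"
        using S by (simp add: ennreal_mult'[symmetric] ennreal_plus flip: ennreal_1)
      also have "1 + S * (1 / (1 - S)) = 1 / (1 - S)" using S by (simp add: field_simps)
      finally show ?thesis using True by (simp add: S_def)
    next
      case False
      then show ?thesis using prod_trunc_recip_eq_0[OF I(1), of _ x a] by (auto simp: not_le)
    qed
  qed
  also have "\<dots> = cut_integral I a (1 - a) + (\<Sum>j\<in>I. \<integral>\<^sup>+x. ennreal (x j) * ?\<phi> (\<Sum>i\<in>I. x i) * ?P x \<partial>(\<Pi>\<^sub>M i\<in>I. lborel))"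
    unfolding cut_integral_def by (subst nn_integral_add; (subst nn_integral_sum)?) measurable
  also have "(\<Sum>j\<in>I. \<integral>\<^sup>+x. ennreal (x j) * ?\<phi> (\<Sum>i\<in>I. x i) * ?P x \<partial>(\<Pi>\<^sub>M i\<in>I. lborel)) = (\<Sum>j\<in>I. cut_integral I a (1 - a))"
  proof (intro sum.cong refl)
    fix j assume j: "j \<in> I"
    have "(\<integral>\<^sup>+x. ennreal (x j) * ?\<phi> (\<Sum>i\<in>I. x i) * ?P x \<partial>(\<Pi>\<^sub>M i\<in>I. lborel)) =
        (\<integral>\<^sup>+w. ?\<phi> w * cut_integral (I - {j}) a (w - a) \<partial>lborel)"
      by (intro nn_integral_size_biased I j a) measurable
    also have "\<dots> = (\<integral>\<^sup>+w. ?\<phi> (1 - w) * cut_integral (I - {j}) a ((1 - w) - a) \<partial>lborel)"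
      \<comment> \<open>the reflection exchanging the two barycentric coordinates\<close>
      using I by (subst nn_integral_real_affine[where c="-1" and t=1]) auto
    also have "\<dots> = (\<integral>\<^sup>+s. ennreal (trunc_recip a s) * cut_integral (I - {j}) a ((1 - a) - s) \<partial>lborel)"
      by (intro nn_integral_cong) (auto simp: trunc_recip_def indicator_def algebra_simps)
    also have "\<dots> = cut_integral I a (1 - a)"
      by (rule cut_integral_remove[symmetric]) (use I j a in auto)
    finally show "(\<integral>\<^sup>+x. ennreal (x j) * ?\<phi> (\<Sum>i\<in>I. x i) * ?P x \<partial>(\<Pi>\<^sub>M i\<in>I. lborel)) = cut_integral I a (1 - a)" .
  qed
  finally show ?thesis by (simp add: algebra_simps)
qed

section \<open>The recursively defined integral and its expansions\<close>

text \<open>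
  The value of \<open>cut_integral I 1 u\<close> for \<open>card I = n\<close> and \<open>u \<ge> n\<close>. Below \<open>u = n\<close> the domain of
  integration is empty, but \<open>cut_fun 0\<close> is \<open>1\<close> everywhere, so all statements about \<open>cut_fun n\<close>
  are confined to \<open>{real n..}\<close>.
\<close>

fun cut_fun :: "nat \<Rightarrow> real \<Rightarrow> real" where
  "cut_fun 0 u = 1"
| "cut_fun (Suc n) u = real (Suc n) * integral {real (Suc n)..u} (\<lambda>w. cut_fun n (w - 1) / w)"

lemma continuous_on_cut_fun_integrand:
  assumes "continuous_on {real n..} (cut_fun n)"
  shows "continuous_on {real (Suc n)..} (\<lambda>w. cut_fun n (w - 1) / w)"
  by (intro continuous_intros continuous_on_compose2[OF assms]) auto

text \<open>
  Continuity of \<open>cut_fun n\<close> is a hypothesis here because it is itself obtained, in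
  \<open>continuous_on_cut_fun\<close>, from the derivative in one dimension less.
\<close>

lemma cut_fun_derivative_aux:
  assumes "continuous_on {real n..} (cut_fun n)" "u \<ge> real (Suc n)"
  shows "(cut_fun (Suc n) has_real_derivative real (Suc n) * cut_fun n (u - 1) / u)
           (at u within {real (Suc n)..})"
proof -
  have "((\<lambda>u. integral {real (Suc n)..u} (\<lambda>w. cut_fun n (w - 1) / w)) has_real_derivative cut_fun n (u - 1) / u)
          (at u within {real (Suc n)..u + 1})"
    by (rule integral_has_real_derivative)
       (use assms in \<open>auto intro: continuous_on_subset[OF continuous_on_cut_fun_integrand]\<close>)
  then have "(cut_fun (Suc n) has_real_derivative real (Suc n) * (cut_fun n (u - 1) / u))
           (at u within {real (Suc n)..u + 1})"
    by (subst cut_fun.simps(2)[abs_def]) (rule DERIV_cmult)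
  moreover have "at u within {real (Suc n)..u + 1} = at u within {real (Suc n)..}"
    by (rule at_within_nhd[of _ "{..<u + 1}"]) (use assms in auto)
  ultimately show ?thesis by simp
qed

lemma continuous_on_cut_fun: "continuous_on {real n..} (cut_fun n)"
proof (induction n)
  case (Suc n)
  then show ?case
    by (intro DERIV_continuous_on[OF cut_fun_derivative_aux]) auto
qed simp

lemmas cut_fun_derivative = cut_fun_derivative_aux[OF continuous_on_cut_fun]

lemma cut_fun_derivative_interior:
  assumes "u > real (Suc n)"
  shows "(cut_fun (Suc n) has_real_derivative real (Suc n) * cut_fun n (u - 1) / u) (at u)"
proof -
  have "at u within {real (Suc n)..} = at u"
    by (rule at_within_nhd[of _ "{real (Suc n)<..}"]) (use assms in auto)
  then show ?thesis using cut_fun_derivative[of n u] assms by simp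
qed

lemma cut_fun_nonneg: "u \<ge> real n \<Longrightarrow> cut_fun n u \<ge> 0"
proof (induction n arbitrary: u)
  case (Suc n)
  have "integral {real (Suc n)..u} (\<lambda>w. cut_fun n (w - 1) / w) \<ge> 0"
    by (intro integral_nonneg integrable_continuous_real continuous_on_subset[OF continuous_on_cut_fun_integrand])
       (auto intro!: continuous_on_cut_fun divide_nonneg_nonneg Suc.IH)
  then show ?case by simp
qed simp

lemma cut_fun_1: "u \<ge> 1 \<Longrightarrow> cut_fun (Suc 0) u = ln u"
proof -
  assume u: "u \<ge> 1"
  have "((\<lambda>w. 1 / w) has_integral (ln u - ln 1)) {1..u}"
    by (intro fundamental_theorem_of_calculus)
       (use u in \<open>auto simp flip: has_real_derivative_iff_has_vector_derivative intro!: derivative_eq_intros\<close>)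
  then show ?thesis by (simp add: integral_unique)
qed

text \<open>
  By l'Hopital it suffices to compare derivatives, and these are
  \<open>(n + 2) / u\<close> times the corresponding difference in one dimension less, evaluated at \<open>u - 1\<close>; the
  shift by \<open>1\<close> is harmless because \<open>ln (u - 1) - ln u\<close> tends to \<open>0\<close>. In the lowest
  dimension the difference vanishes identically.
\<close>

lemma cut_fun_at_top:
  "((\<lambda>u. (cut_fun (Suc n) u - ln u ^ Suc n) / ln u ^ n) \<longlongrightarrow> 0) at_top"
proof (induction n)
  case 0
  have "\<forall>\<^sub>F u in at_top. (cut_fun (Suc 0) u - ln u ^ Suc 0) / ln u ^ 0 = (0::real)"
    using eventually_ge_at_top[of 1] by eventually_elim (simp add: cut_fun_1 del: cut_fun.simps)
  then show ?case by (rule tendsto_eventually)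
next
  case (Suc n)
  define \<delta> where "\<delta> = (\<lambda>u. (cut_fun (Suc n) u - ln u ^ Suc n) / ln u ^ n)"
  let ?m = "real (Suc (Suc n))"
  let ?f' = "\<lambda>u. ?m * cut_fun (Suc n) (u - 1) / u - ?m * ln u ^ Suc n / u"
  let ?g' = "\<lambda>u. real (Suc n) * ln u ^ n / u"
  show ?case
  proof (rule lhospital_at_top_at_top[where f' = ?f' and g' = ?g'])
    show "filterlim (\<lambda>u::real. ln u ^ Suc n) at_top at_top"
      by (intro filterlim_pow_at_top ln_at_top) auto
    show "\<forall>\<^sub>F u in at_top. ?g' u \<noteq> 0"
      using eventually_gt_at_top[of 1] by eventually_elim auto
    show "\<forall>\<^sub>F u in at_top. ((\<lambda>u. cut_fun (Suc (Suc n)) u - ln u ^ Suc (Suc n)) has_real_derivative ?f' u) (at u)"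
      using eventually_gt_at_top[of ?m]
    proof eventually_elim
      case (elim u)
      have "((\<lambda>u. ln u ^ Suc (Suc n)) has_real_derivative ?m * ln u ^ Suc n / u) (at u)"
        using DERIV_power_Suc[OF DERIV_ln[of u], of "Suc n"] elim by (simp add: field_simps)
      then show ?case by (rule DERIV_diff[OF cut_fun_derivative_interior[OF elim]])
    qed
    show "\<forall>\<^sub>F u in at_top. ((\<lambda>u. ln u ^ Suc n) has_real_derivative ?g' u) (at u)"
      using eventually_gt_at_top[of 1]
    proof eventually_elim
      case (elim u)
      then show ?case using DERIV_power_Suc[OF DERIV_ln[of u], of n] by (simp add: field_simps)
    qed
    have 1: "((\<lambda>u. \<delta> (u - 1) * (ln (u - 1) / ln u) ^ n) \<longlongrightarrow> 0 * 1 ^ n) at_top"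
    proof (intro tendsto_intros)
      show "((\<lambda>u. \<delta> (u - 1)) \<longlongrightarrow> 0) at_top"
        by (rule filterlim_compose[OF Suc[folded \<delta>_def]]) real_asymp
      show "((\<lambda>u::real. ln (u - 1) / ln u) \<longlongrightarrow> 1) at_top"
        by real_asymp
    qed
    have 2: "((\<lambda>u::real. (ln (u - 1) ^ Suc n - ln u ^ Suc n) / ln u ^ n) \<longlongrightarrow> 0) at_top"
      by real_asymp
    have "((\<lambda>u. ?m / real (Suc n) * (\<delta> (u - 1) * (ln (u - 1) / ln u) ^ n
            + (ln (u - 1) ^ Suc n - ln u ^ Suc n) / ln u ^ n)) \<longlongrightarrow> ?m / real (Suc n) * (0 * 1 ^ n + 0)) at_top"
      by (intro tendsto_intros 1 2)
    moreover have "\<forall>\<^sub>F u in at_top. ?m / real (Suc n) * (\<delta> (u - 1) * (ln (u - 1) / ln u) ^ n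
            + (ln (u - 1) ^ Suc n - ln u ^ Suc n) / ln u ^ n) = ?f' u / ?g' u"
      using eventually_gt_at_top[of 2]
    proof eventually_elim
      case (elim u)
      then have "ln (u - 1) > 0" "ln u > 0" by auto
      then have "\<delta> (u - 1) * (ln (u - 1) / ln u) ^ n = (cut_fun (Suc n) (u - 1) - ln (u - 1) ^ Suc n) / ln u ^ n"
        by (simp add: \<delta>_def power_divide del: cut_fun.simps)
      then have "\<delta> (u - 1) * (ln (u - 1) / ln u) ^ n + (ln (u - 1) ^ Suc n - ln u ^ Suc n) / ln u ^ n
         = (cut_fun (Suc n) (u - 1) - ln u ^ Suc n) / ln u ^ n"
        by (simp only: add_divide_distrib[symmetric]) simp
      moreover have "M / N * ((A - B) / q) = (M * A / u - M * B / u) / (N * q / u)"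
        if "N > 0" "q > 0" for M N A B q :: real
        using that elim by (simp add: field_simps)
      ultimately show ?case using \<open>ln u > 0\<close> by (simp del: cut_fun.simps power_Suc of_nat_Suc)
    qed
    ultimately show "((\<lambda>u. ?f' u / ?g' u) \<longlongrightarrow> 0) at_top"
      by (simp add: tendsto_cong del: cut_fun.simps)
  qed
qed

text \<open>
  The coefficient \<open>d\<^sub>n\<close> of the second term, relative to the first, satisfies
  \<open>(n + 1) d\<^sub>n = n d\<^bsub>n-1\<^esub> + 1\<close>: the \<open>1\<close> stems from the factor \<open>n / (n + h) = 1 - h / n + \<dots>\<close> in the
  derivative. The solution is \<open>d\<^sub>n = n / (n + 1)\<close>.
\<close>

lemma cut_fun_at_right:
  "((\<lambda>h. (cut_fun n (real n + h) - (h ^ n / fact n - real n / fact (Suc n) * h ^ Suc n)) / h ^ Suc n) \<longlongrightarrow> 0) (at_right 0)"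
proof (induction n)
  case (Suc n)
  define \<delta> where "\<delta> = (\<lambda>h. (cut_fun n (real n + h) - (h ^ n / fact n - real n / fact (Suc n) * h ^ Suc n)) / h ^ Suc n)"
  let ?m = "real (Suc n)"
  let ?f = "\<lambda>h. cut_fun (Suc n) (?m + h) - (h ^ Suc n / fact (Suc n) - ?m / fact (Suc (Suc n)) * h ^ Suc (Suc n))"
  let ?f' = "\<lambda>h. ?m * cut_fun n (real n + h) / (?m + h) - (h ^ n / fact n - h ^ Suc n / fact n)"
  let ?g' = "\<lambda>h. real (Suc (Suc n)) * h ^ Suc n"
  have pos: "\<forall>\<^sub>F h in at_right 0. (h::real) > 0"
    by (simp add: eventually_at_right_less)
  show ?case
  proof (rule lhopital_right_0[where f' = ?f' and g' = ?g'])
    have "((\<lambda>h. ?f h) \<longlongrightarrow> ?f 0) (at_right 0)"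
    proof -
      have "continuous_on {0..} ?f"
        by (intro continuous_intros continuous_on_compose2[OF continuous_on_cut_fun[of "Suc n"]]) auto
      then have "(?f \<longlongrightarrow> ?f 0) (at 0 within {0..})"
        by (auto simp only: continuous_on_def atLeast_iff order_refl)
      then show ?thesis by (rule tendsto_within_subset) auto
    qed
    then show "(?f \<longlongrightarrow> 0) (at_right 0)" by simp
    show "((\<lambda>h::real. h ^ Suc (Suc n)) \<longlongrightarrow> 0) (at_right 0)"
      by (auto intro!: tendsto_eq_intros)
    show "\<forall>\<^sub>F h::real in at_right 0. h ^ Suc (Suc n) \<noteq> 0" "\<forall>\<^sub>F h in at_right 0. ?g' h \<noteq> 0"
      using pos by (eventually_elim, simp)+
    show "\<forall>\<^sub>F h in at_right 0. (?f has_real_derivative ?f' h) (at h)"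
      using pos
    proof eventually_elim
      case (elim h)
      have "((\<lambda>h. cut_fun (Suc n) (?m + h)) has_real_derivative ?m * cut_fun n (?m + h - 1) / (?m + h)) (at h)"
        using cut_fun_derivative_interior[of n "?m + h"] elim
        by (simp add: DERIV_shift add.commute del: cut_fun.simps)
      moreover have "((\<lambda>h. h ^ Suc n / fact (Suc n) - ?m / fact (Suc (Suc n)) * h ^ Suc (Suc n))
           has_real_derivative (h ^ n / fact n - h ^ Suc n / fact n)) (at h)"
      proof -
        have "?m * h ^ n / fact (Suc n) = h ^ n / fact n"
          by (simp add: fact_Suc divide_simps del: of_nat_Suc)
        moreover have "?m / fact (Suc (Suc n)) * (real (Suc (Suc n)) * h ^ Suc n) = h ^ Suc n / fact n"
          by (simp add: fact_Suc divide_simps del: of_nat_Suc)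
        moreover have "((\<lambda>h. h ^ Suc n / fact (Suc n) - ?m / fact (Suc (Suc n)) * h ^ Suc (Suc n)) has_real_derivative
             ?m * h ^ n / fact (Suc n) - ?m / fact (Suc (Suc n)) * (real (Suc (Suc n)) * h ^ Suc n)) (at h)"
          by (rule DERIV_diff DERIV_cdivide DERIV_cmult DERIV_pow[where s=UNIV, THEN DERIV_cong] refl
                | simp del: fact_Suc of_nat_Suc power_Suc)+
        ultimately show ?thesis by simp
      qed
      ultimately show ?case
        using DERIV_diff by (fastforce simp: algebra_simps)
    qed
    show "\<forall>\<^sub>F h in at_right 0. ((\<lambda>h. h ^ Suc (Suc n)) has_real_derivative ?g' h) (at h)"
      using DERIV_power_Suc[OF DERIV_ident, of "Suc n", where ?'a = real] by simp
    let ?L = "\<lambda>h. (?m / (?m + h) * (\<delta> h - real n / fact (Suc n)) + 1 / fact n - 1 / fact n * (1 / (?m + h))) / real (Suc (Suc n))"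
    have "(?L \<longlongrightarrow> (?m / (?m + 0) * (0 - real n / fact (Suc n)) + 1 / fact n - 1 / fact n * (1 / (?m + 0))) / real (Suc (Suc n))) (at_right 0)"
      by (intro tendsto_intros Suc[folded \<delta>_def]) auto
    also have "(?m / (?m + 0) * (0 - real n / fact (Suc n)) + 1 / fact n - 1 / fact n * (1 / (?m + 0))) / real (Suc (Suc n)) = 0"
    proof -
      have "- (real n / (?m * f)) + 1 / f - 1 / f * (1 / ?m) = 0" if "f > 0" for f :: real
        using that by (simp add: divide_simps)
      from this[of "fact n"] show ?thesis by (simp add: fact_Suc del: of_nat_Suc)
    qed
    finally have "(?L \<longlongrightarrow> 0) (at_right 0)" .
    moreover have "\<forall>\<^sub>F h in at_right 0. ?L h = ?f' h / ?g' h"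
      using pos
    proof eventually_elim
      case (elim h)
      have "cut_fun n (real n + h) = \<delta> h * h ^ Suc n + (h ^ n / fact n - real n / fact (Suc n) * h ^ Suc n)"
        using elim by (simp add: \<delta>_def)
      moreover have "(?m / (?m + h) * (d - real n / (?m * f)) + 1 / f - 1 / f * (1 / (?m + h))) / M
          = (?m * (d * (h * q) + (q / f - real n / (?m * f) * (h * q))) / (?m + h) - (q / f - h * q / f)) / (M * (h * q))"
        if "q > 0" "f > 0" "M > 0" for d q f M :: real
      proof -
        have "?m + h > 0" "?m > 0" "?m = real n + 1" using elim by auto
        with that elim show ?thesis by (simp add: divide_simps del: of_nat_Suc) (simp add: algebra_simps)
      qed
      from this[of "h ^ n" "fact n" "real (Suc (Suc n))" "\<delta> h"]
      have "?L h = (?m * (\<delta> h * h ^ Suc n + (h ^ n / fact n - real n / fact (Suc n) * h ^ Suc n)) / (?m + h)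
          - (h ^ n / fact n - h ^ Suc n / fact n)) / ?g' h"
        using elim by (simp del: of_nat_Suc add: fact_Suc)
      ultimately show ?case by simp
    qed
    ultimately show "((\<lambda>h. ?f' h / ?g' h) \<longlongrightarrow> 0) (at_right 0)"
      by (simp add: tendsto_cong del: cut_fun.simps)
  qed
qed simp

text \<open>
  All \<open>card I\<close> summands of the recursion agree by the induction hypothesis, and
  \<open>w \<mapsto> cut_fun (Suc n) (w / a)\<close> is an antiderivative of their common integrand, which vanishes at
  the lower limit \<open>a * Suc n\<close>.
\<close>

lemma cut_integral_eq_cut_fun:
  assumes "finite I" and a: "a > 0"
  shows "cut_integral I a t = (if a * real (card I) \<le> t then ennreal (cut_fun (card I) (t / a)) else 0)"
  using assms(1)
proof (induction "card I" arbitrary: I t)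
  case 0
  interpret product_sigma_finite "\<lambda>_. lborel :: real measure"
    by (rule product_sigma_finite_lborel)
  from 0 have "I = {}" by simp
  then show ?case by (simp add: cut_integral_def nn_integral_empty del: nn_integral_indicator nn_integral_const)
next
  case (Suc n)
  have an: "0 < a * real (Suc n)" using a by simp
  have "cut_integral I a t = (\<Sum>j\<in>I. \<integral>\<^sup>+w. ennreal (1 / w) * indicator {..t} w * cut_integral (I - {j}) a (w - a) \<partial>lborel)"
    using Suc.hyps(2) by (intro cut_integral_recursion Suc.prems a) auto
  also have "\<dots> = (\<Sum>j\<in>I. \<integral>\<^sup>+w. ennreal (cut_fun n (w / a - 1) / w * indicator {a * real (Suc n)..t} w) \<partial>lborel)"
  proof (intro sum.cong refl nn_integral_cong)
    fix j w assume j: "j \<in> I"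
    have c: "card (I - {j}) = n" using Suc j by simp
    have e: "cut_integral (I - {j}) a (w - a) = (if a * real n \<le> w - a then ennreal (cut_fun n (w / a - 1)) else 0)"
      using Suc.hyps(1)[of "I - {j}" "w - a"] c Suc.prems a by (simp add: diff_divide_distrib)
    show "ennreal (1 / w) * indicator {..t} w * cut_integral (I - {j}) a (w - a) =
       ennreal (cut_fun n (w / a - 1) / w * indicator {a * real (Suc n)..t} w)"
    proof (cases "a * real (Suc n) \<le> w")
      case True
      moreover have "w > 0" using True an by linarith
      ultimately show ?thesis unfolding e by (auto simp: ennreal_mult'[symmetric] indicator_def algebra_simps)
    next
      case False
      then show ?thesis unfolding e by (auto simp: algebra_simps)
    qed
  qed
  also have "\<dots> = of_nat (Suc n) * (\<integral>\<^sup>+w. ennreal (cut_fun n (w / a - 1) / w * indicator {a * real (Suc n)..t} w) \<partial>lborel)"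
    using Suc.hyps(2) by (simp del: of_nat_Suc)
  also have "\<dots> = (if a * real (Suc n) \<le> t then ennreal (cut_fun (Suc n) (t / a)) else 0)"
  proof (cases "a * real (Suc n) \<le> t")
    case True
    let ?g = "\<lambda>w. cut_fun n (w / a - 1) / w"
    have pos: "w > 0" "w / a \<ge> real (Suc n)" if "w \<ge> a * real (Suc n)" for w
      using that an a by (linarith, simp add: le_divide_eq mult.commute)
    have "((\<lambda>w. real (Suc n) * ?g w) has_integral (cut_fun (Suc n) (t / a) - cut_fun (Suc n) (a * real (Suc n) / a))) {a * real (Suc n)..t}"
    proof (rule fundamental_theorem_of_calculus[OF True], fold has_real_derivative_iff_has_vector_derivative)
      fix w assume w: "w \<in> {a * real (Suc n)..t}"
      then have p: "w > 0" "w / a \<ge> real (Suc n)" using pos by auto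
      have "((\<lambda>w. cut_fun (Suc n) (w / a)) has_real_derivative real (Suc n) * cut_fun n (w / a - 1) / (w / a) * (1 / a)) (at w within {a * real (Suc n)..t})"
      proof (rule DERIV_image_chain[where g = "\<lambda>w. w / a", unfolded o_def])
        show "((\<lambda>w. w / a) has_real_derivative 1 / a) (at w within {a * real (Suc n)..t})"
          using a by (auto intro!: derivative_eq_intros)
        show "(cut_fun (Suc n) has_real_derivative real (Suc n) * cut_fun n (w / a - 1) / (w / a)) (at (w / a) within (\<lambda>w. w / a) ` {a * real (Suc n)..t})"
          by (rule DERIV_subset[OF cut_fun_derivative[OF p(2)]]) (use pos in auto)
      qed
      moreover have "real (Suc n) * cut_fun n (w / a - 1) / (w / a) * (1 / a) = real (Suc n) * ?g w"
        using a by simp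
      ultimately show "((\<lambda>w. cut_fun (Suc n) (w / a)) has_real_derivative real (Suc n) * ?g w) (at w within {a * real (Suc n)..t})"
        by (simp only:)
    qed
    moreover have "cut_fun (Suc n) (a * real (Suc n) / a) = 0"
      using a by simp
    ultimately have "((\<lambda>w. real (Suc n) * ?g w) has_integral (cut_fun (Suc n) (t / a))) {a * real (Suc n)..t}"
      by (simp only: diff_zero)
    from has_integral_mult_right[OF this, of "1 / real (Suc n)"]
    have I: "(?g has_integral (cut_fun (Suc n) (t / a) / real (Suc n))) {a * real (Suc n)..t}"
      by (simp del: of_nat_Suc cut_fun.simps)
    have nn: "?g w \<ge> 0" if "w \<in> {a * real (Suc n)..t}" for w
      using that pos[of w] by (auto intro!: divide_nonneg_nonneg cut_fun_nonneg)
    have "(\<integral>\<^sup>+w. ennreal (?g w * indicator {a * real (Suc n)..t} w) \<partial>lborel) = ennreal (cut_fun (Suc n) (t / a) / real (Suc n))"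
      using nn_integral_has_integral_lebesgue[OF nn I] by (simp add: mult.commute)
    then have "of_nat (Suc n) * (\<integral>\<^sup>+w. ennreal (?g w * indicator {a * real (Suc n)..t} w) \<partial>lborel)
        = ennreal (real (Suc n)) * ennreal (cut_fun (Suc n) (t / a) / real (Suc n))"
      by (simp add: ennreal_of_nat_eq_real_of_nat del: of_nat_Suc)
    also have "\<dots> = ennreal (cut_fun (Suc n) (t / a))"
      by (simp add: ennreal_mult'[symmetric] del: of_nat_Suc cut_fun.simps)
    finally show ?thesis using True by simp
  qed (simp add: indicator_def)
  finally show ?case by (simp add: Suc.hyps(2)[symmetric])
qed

section \<open>The volume of the polar body of the simplex\<close>

lemma nn_integral_lborel_PiM_Basis:
  fixes f :: "'a::euclidean_space \<Rightarrow> ennreal"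
  assumes "f \<in> borel_measurable borel"
  shows "(\<integral>\<^sup>+x. f x \<partial>lborel) = (\<integral>\<^sup>+z. f (\<Sum>b\<in>Basis. z b *\<^sub>R b) \<partial>(\<Pi>\<^sub>M b\<in>Basis. lborel))"
  using assms by (subst lborel_eq) (simp add: nn_integral_distr)

text \<open>
  Fubini in the direction \<open>j\<close>: as \<open>g\<close> does not depend on that coordinate, the shear is a
  translation on each line parallel to \<open>j\<close>.
\<close>

lemma nn_integral_shear:
  fixes f :: "'a::euclidean_space \<Rightarrow> ennreal" and g :: "'a \<Rightarrow> real"
  assumes [measurable]: "f \<in> borel_measurable borel" "g \<in> borel_measurable borel"
    and j: "j \<in> Basis" and g: "\<And>x s. g (x + s *\<^sub>R j) = g x"
  shows "(\<integral>\<^sup>+x. f (x + g x *\<^sub>R j) \<partial>lborel) = (\<integral>\<^sup>+x. f x \<partial>lborel)"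
proof -
  interpret product_sigma_finite "\<lambda>_. lborel :: real measure"
    by (rule product_sigma_finite_lborel)
  define J where "J = Basis - {j}"
  have J: "finite J" "j \<notin> J" "(Basis :: 'a set) = insert j J" using j by (auto simp: J_def)
  have fubini: "(\<integral>\<^sup>+x. h x \<partial>lborel) = (\<integral>\<^sup>+y. \<integral>\<^sup>+s. h ((\<Sum>b\<in>J. y b *\<^sub>R b) + s *\<^sub>R j) \<partial>lborel \<partial>(\<Pi>\<^sub>M b\<in>J. lborel))"
    if [measurable]: "h \<in> borel_measurable borel" for h :: "'a \<Rightarrow> ennreal"
    unfolding nn_integral_lborel_PiM_Basis[OF that] J(3)
  proof (subst product_nn_integral_insert[OF J(1,2)], goal_cases)
    case 2
    have "(\<Sum>b\<in>J. (y(j := s)) b *\<^sub>R b) = (\<Sum>b\<in>J. y b *\<^sub>R b)" for y s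
      using J(2) by (auto intro!: sum.cong)
    then show ?case using J(1,2) by (simp add: add.commute)
  qed measurable
  have "(\<integral>\<^sup>+x. f (x + g x *\<^sub>R j) \<partial>lborel) =
      (\<integral>\<^sup>+y. \<integral>\<^sup>+s. f ((\<Sum>b\<in>J. y b *\<^sub>R b) + s *\<^sub>R j + g (\<Sum>b\<in>J. y b *\<^sub>R b) *\<^sub>R j) \<partial>lborel \<partial>(\<Pi>\<^sub>M b\<in>J. lborel))"
    by (subst fubini) (simp_all add: g)
  also have "\<dots> = (\<integral>\<^sup>+y. \<integral>\<^sup>+s. f ((\<Sum>b\<in>J. y b *\<^sub>R b) + s *\<^sub>R j) \<partial>lborel \<partial>(\<Pi>\<^sub>M b\<in>J. lborel))"
  proof (rule nn_integral_cong, goal_cases)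
    case (1 y)
    show ?case
      by (subst (2) nn_integral_real_affine[where c=1 and t="g (\<Sum>b\<in>J. y b *\<^sub>R b)"])
         (simp_all add: algebra_simps)
  qed
  also have "\<dots> = (\<integral>\<^sup>+x. f x \<partial>lborel)"
    by (subst fubini) simp_all
  finally show ?thesis .
qed

text \<open>
  Adding multiples of the fixed coordinate \<open>k\<close> to the coordinates in \<open>S\<close> is a composition of
  shears in one direction each, none of which changes the coordinate \<open>k\<close>.
\<close>

lemma nn_integral_column_shear:
  fixes f :: "'a::euclidean_space \<Rightarrow> ennreal"
  assumes f: "f \<in> borel_measurable borel" and S: "finite S" "S \<subseteq> Basis - {k}" and k: "k \<in> Basis"
  shows "(\<integral>\<^sup>+x. f (x + (x \<bullet> k) *\<^sub>R (\<Sum>j\<in>S. c j *\<^sub>R j)) \<partial>lborel) = (\<integral>\<^sup>+x. f x \<partial>lborel)"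
  using S
proof (induction S rule: finite_induct)
  case (insert j S)
  note [measurable] = f
  let ?T = "\<lambda>x. x + (x \<bullet> k) *\<^sub>R (\<Sum>j\<in>S. c j *\<^sub>R j)"
  have j: "j \<in> Basis" "j \<bullet> k = 0" using insert.prems k by (auto simp: inner_Basis)
  have eq: "x + (x \<bullet> k) *\<^sub>R (\<Sum>j\<in>insert j S. c j *\<^sub>R j) = ?T (x + ((x \<bullet> k) * c j) *\<^sub>R j)" for x
    using insert.hyps j by (simp add: inner_add_left scaleR_add_right)
  have "(\<integral>\<^sup>+x. f (x + (x \<bullet> k) *\<^sub>R (\<Sum>j\<in>insert j S. c j *\<^sub>R j)) \<partial>lborel)
      = (\<integral>\<^sup>+x. f (?T (x + ((x \<bullet> k) * c j) *\<^sub>R j)) \<partial>lborel)"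
    by (simp only: eq)
  also have "\<dots> = (\<integral>\<^sup>+x. f (?T x) \<partial>lborel)"
    by (rule nn_integral_shear[where f = "\<lambda>x. f (?T x)"]) (use j in \<open>auto simp: inner_add_left\<close>)
  also have "\<dots> = (\<integral>\<^sup>+x. f x \<partial>lborel)"
    using insert by simp
  finally show ?case .
qed simp

lemma sum_Basis_vec: "(\<Sum>b\<in>Basis. f (x \<bullet> b)) = (\<Sum>i\<in>UNIV. f (x $ i))" for x :: "real ^ 'n"
  by (rule sum.reindex_bij_witness[of _ "\<lambda>i. axis i 1" "\<lambda>b. SOME i. b = axis i 1"])
     (auto simp: Basis_vec_def axis_eq_axis inner_axis)

lemma prod_Basis_vec: "(\<Prod>b\<in>Basis. f (x \<bullet> b)) = (\<Prod>i\<in>UNIV. f (x $ i))" for x :: "real ^ 'n"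
  by (rule prod.reindex_bij_witness[of _ "\<lambda>i. axis i 1" "\<lambda>b. SOME i. b = axis i 1"])
     (auto simp: Basis_vec_def axis_eq_axis inner_axis)

lemma std_simplex_vec: "std_simplex = {x :: real ^ 'n. (\<forall>i. 0 \<le> x $ i) \<and> (\<Sum>i\<in>UNIV. x $ i) \<le> 1}"
  unfolding std_simplex_def std_simplex sum_Basis_vec[where f = "\<lambda>x. x"]
  by (auto simp: Basis_vec_def inner_axis)

text \<open>
  A linear functional attains its maximum on the simplex at a vertex, so it suffices to test the
  defining inequality at \<open>0\<close> and at the basis vectors.
\<close>

lemma polar_at_std_simplex:
  "polar_at std_simplex x = {\<xi> :: real ^ 'n. 0 \<le> 1 + \<xi> \<bullet> x \<and> (\<forall>i. \<xi> $ i \<le> 1 + \<xi> \<bullet> x)}"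
proof -
  have "\<xi> \<in> polar_at std_simplex x \<longleftrightarrow> std_simplex \<subseteq> {y. \<xi> \<bullet> y \<le> 1 + \<xi> \<bullet> x}" for \<xi>
    by (auto simp: polar_at_def inner_diff_right algebra_simps)
  moreover have "std_simplex \<subseteq> {y. \<xi> \<bullet> y \<le> 1 + \<xi> \<bullet> x} \<longleftrightarrow> insert 0 Basis \<subseteq> {y. \<xi> \<bullet> y \<le> 1 + \<xi> \<bullet> x}" for \<xi>
    unfolding std_simplex_def by (rule subset_hull) (rule convex_halfspace_le)
  moreover have "insert 0 Basis \<subseteq> {y. \<xi> \<bullet> y \<le> 1 + \<xi> \<bullet> x} \<longleftrightarrow> 0 \<le> 1 + \<xi> \<bullet> x \<and> (\<forall>i. \<xi> $ i \<le> 1 + \<xi> \<bullet> x)" for \<xi>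
    by (simp add: Basis_vec_def inner_axis UN_subset_iff)
  ultimately show ?thesis by blast
qed

lemma nn_integral_diagonal_affine:
  fixes f :: "real ^ 'n \<Rightarrow> ennreal"
  assumes [measurable]: "f \<in> borel_measurable borel" and c: "\<And>i. c $ i \<noteq> 0"
  shows "(\<integral>\<^sup>+x. f x \<partial>lborel) = ennreal (\<Prod>i\<in>UNIV. \<bar>c $ i\<bar>) * (\<integral>\<^sup>+x. f (t + (\<chi> i. c $ i * x $ i)) \<partial>lborel)"
proof -
  have T: "(\<Sum>j\<in>Basis. ((c \<bullet> j) * (x \<bullet> j)) *\<^sub>R j) = (\<chi> i. c $ i * x $ i)" for x
  proof -
    have "(c \<bullet> j) * (x \<bullet> j) = (\<chi> i. c $ i * x $ i) \<bullet> j" if "j \<in> Basis" for j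
      using that by (auto simp: Basis_vec_def inner_axis)
    then have "(\<Sum>j\<in>Basis. ((c \<bullet> j) * (x \<bullet> j)) *\<^sub>R j) = (\<Sum>j\<in>Basis. ((\<chi> i. c $ i * x $ i) \<bullet> j) *\<^sub>R j)"
      by (intro sum.cong) auto
    then show ?thesis by (simp only: euclidean_representation)
  qed
  have [measurable]: "(\<lambda>x. t + (\<chi> i. c $ i * x $ i)) \<in> borel_measurable borel"
    unfolding T[symmetric] by measurable
  have c': "c \<bullet> j \<noteq> 0" if "j \<in> Basis" for j
    using that c by (auto simp: Basis_vec_def inner_axis)
  have "(\<integral>\<^sup>+x. f x \<partial>lborel) = (\<integral>\<^sup>+x. f x \<partial>density (distr lborel borel (\<lambda>x. t + (\<chi> i. c $ i * x $ i))) (\<lambda>_. \<Prod>j\<in>Basis. \<bar>c \<bullet> j\<bar>))"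
    by (subst lborel_affine_euclidean[where c = "\<lambda>j. c \<bullet> j" and t = t]) (simp_all only: T c' not_False_eq_True simp_thms)
  also have "\<dots> = ennreal (\<Prod>i\<in>UNIV. \<bar>c $ i\<bar>) * (\<integral>\<^sup>+x. f (t + (\<chi> i. c $ i * x $ i)) \<partial>lborel)"
    by (simp add: nn_integral_density nn_integral_distr nn_integral_cmult prod_Basis_vec)
  finally show ?thesis .
qed

text \<open>
  Write \<open>s\<close> for the sum of the \<open>x\<^sub>i\<close>. The inequalities of the polar body read \<open>w\<^sub>i \<ge> 0\<close> for
  \<open>w\<^sub>i = x\<^sub>i (1 + \<xi> \<bullet> x - \<xi>\<^sub>i)\<close> and \<open>w\<^sub>0 = (1 - s) (1 + \<xi> \<bullet> x)\<close>, and these \<open>n + 1\<close> numbers add up to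
  \<open>1\<close>. So any \<open>n\<close> of them are affine coordinates that identify the polar body with the
  standard simplex. The coordinates used are \<open>w\<^sub>i\<close> for \<open>i \<noteq> k\<close> and, in the place \<open>k\<close>, the number \<open>w\<^sub>0\<close>,
  for a fixed index \<open>k\<close>. The map from \<open>w\<close> back to \<open>\<xi>\<close> is then the product of
  two shears and two diagonal maps, and its determinant can be read off.
\<close>

lemma emeasure_polar_at_std_simplex:
  fixes x :: "real ^ 'n"
  assumes pos: "\<And>i. x $ i > 0" and S: "(\<Sum>i\<in>UNIV. x $ i) < 1"
  shows "emeasure lborel (polar_at std_simplex x) =
     ennreal (1 / fact CARD('n) * (1 / ((\<Prod>i\<in>UNIV. x $ i) * (1 - (\<Sum>i\<in>UNIV. x $ i)))))"
proof -
  \<comment> \<open>only the existence of an index matters, so any element of the type will do\<close>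
  define k :: 'n where "k = undefined"
  define s where "s = (\<Sum>i\<in>UNIV. x $ i)"
  define s' where "s' = (\<Sum>i\<in>-{k}. x $ i)"
  define p where "p = (\<Prod>i\<in>-{k}. x $ i)"
  have split: "(\<Sum>i\<in>UNIV. f i) = f k + (\<Sum>i\<in>-{k}. f i)" for f :: "'n \<Rightarrow> real"
    by (subst sum.remove[of _ k]) (auto simp: Compl_eq_Diff_UNIV)
  have psplit: "(\<Prod>i\<in>UNIV. f i) = f k * (\<Prod>i\<in>-{k}. f i)" for f :: "'n \<Rightarrow> real"
    by (subst prod.remove[of _ k]) (auto simp: Compl_eq_Diff_UNIV)
  have s: "s = x $ k + s'" "s < 1" using split S by (auto simp: s_def s'_def)
  have p: "p > 0" unfolding p_def by (intro prod_pos) (use pos in auto)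
  let ?P = "indicator (polar_at std_simplex x) :: real ^ 'n \<Rightarrow> ennreal"
  have "closed (polar_at std_simplex x)"
    unfolding polar_at_std_simplex by (intro closed_Collect_conj closed_Collect_all closed_Collect_le continuous_intros)
  then have [measurable]: "polar_at std_simplex x \<in> sets borel" by (rule borel_closed)
  \<comment> \<open>With \<open>t = \<xi> \<bullet> x\<close>: \<open>T4\<close> passes from \<open>w\<close> to \<open>t\<close> (in place \<open>k\<close>) and \<open>t - \<xi>\<^sub>i\<close>, \<open>T3\<close> subtracts \<open>t\<close> to
    get \<open>- \<xi>\<^sub>i\<close>, \<open>T2\<close> replaces \<open>t\<close> by \<open>x\<^sub>k \<xi>\<^sub>k\<close>, and \<open>T1\<close> rescales to \<open>\<xi>\<close>.\<close>
  define c :: "real ^ 'n" where "c = (\<chi> i. if i = k then 1 / x $ k else - 1)"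
  define d :: "real ^ 'n" where "d = (\<chi> i. if i = k then 1 / (1 - s) else 1 / x $ i)"
  define v :: "real ^ 'n" where "v = (\<Sum>j\<in>Basis - {axis k 1}. (- 1) *\<^sub>R j)"
  define g :: "real ^ 'n \<Rightarrow> real" where "g u = (\<Sum>i\<in>-{k}. x $ i * u $ i)" for u
  define T1 where "T1 = (\<lambda>u. 0 + (\<chi> i. c $ i * u $ i) :: real ^ 'n)"
  define T2 where "T2 = (\<lambda>u. u + g u *\<^sub>R axis k 1)"
  define T3 where "T3 = (\<lambda>u. u + (u \<bullet> axis k 1) *\<^sub>R v)"
  define T4 where "T4 = (\<lambda>w. (\<chi> i. - 1) + (\<chi> i. d $ i * w $ i) :: real ^ 'n)"
  have [measurable]: "T1 \<in> borel_measurable borel" "T2 \<in> borel_measurable borel"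
    "T3 \<in> borel_measurable borel" "g \<in> borel_measurable borel"
    unfolding T1_def T2_def T3_def g_def
    by (intro borel_measurable_continuous_onI continuous_intros)+
  have axis_nth: "axis k 1 $ i = (if i = k then 1 else 0 :: real)" for i
    by (simp add: axis_def)
  have ck: "c $ i \<noteq> 0" and dk: "d $ i \<noteq> 0" for i
    using pos[of i] s by (auto simp: c_def d_def)
  have "emeasure lborel (polar_at std_simplex x) = (\<integral>\<^sup>+\<xi>. ?P \<xi> \<partial>lborel)" by simp
  also have "\<dots> = ennreal (\<Prod>i\<in>UNIV. \<bar>c $ i\<bar>) * (\<integral>\<^sup>+u. ?P (T1 u) \<partial>lborel)"
    unfolding T1_def by (rule nn_integral_diagonal_affine) (use ck in auto)
  also have "(\<integral>\<^sup>+u. ?P (T1 u) \<partial>lborel) = (\<integral>\<^sup>+u. ?P (T1 (T2 u)) \<partial>lborel)"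
    unfolding T2_def by (rule nn_integral_shear[symmetric]) (auto simp: g_def axis_nth intro!: sum.cong)
  also have "\<dots> = (\<integral>\<^sup>+u. ?P (T1 (T2 (T3 u))) \<partial>lborel)"
    unfolding T3_def v_def by (rule nn_integral_column_shear[symmetric]) auto
  also have "\<dots> = ennreal (\<Prod>i\<in>UNIV. \<bar>d $ i\<bar>) * (\<integral>\<^sup>+w. ?P (T1 (T2 (T3 (T4 w)))) \<partial>lborel)"
    unfolding T4_def by (rule nn_integral_diagonal_affine) (use dk in auto)
  also have "(\<integral>\<^sup>+w. ?P (T1 (T2 (T3 (T4 w)))) \<partial>lborel) = (\<integral>\<^sup>+w. indicator (std_simplex :: (real ^ 'n) set) w \<partial>lborel)"
  proof (rule nn_integral_cong)
    fix w :: "real ^ 'n"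
    define t where "t = w $ k / (1 - s) - 1"
    define \<xi> where "\<xi> = T1 (T2 (T3 (T4 w)))"
    have v: "v $ i = (if i = k then 0 else - 1)" for i
    proof -
      have "v $ i = v \<bullet> axis i 1" by (simp add: inner_axis)
      also have "\<dots> = (\<Sum>j\<in>Basis - {axis k 1 :: real ^ 'n}. - (if j = axis i 1 then 1 else 0 :: real))"
        unfolding v_def inner_sum_left by (intro sum.cong) (auto simp: inner_Basis)
      also have "\<dots> = (if i = k then 0 else - 1)"
        by (simp add: sum_negf sum.delta axis_eq_axis)
      finally show ?thesis .
    qed
    have T4: "T4 w $ i = (if i = k then t else w $ i / x $ i - 1)" for i
      by (simp add: T4_def d_def t_def)
    have T3: "T3 (T4 w) $ i = (if i = k then t else w $ i / x $ i - 1 - t)" for i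
      by (simp add: T3_def T4 v inner_axis)
    have "g (T3 (T4 w)) = (\<Sum>i\<in>-{k}. w $ i - x $ i * (1 + t))"
      unfolding g_def by (intro sum.cong) (use pos in \<open>auto simp: T3 field_simps less_imp_neq[OF pos, symmetric]\<close>)
    also have "\<dots> = (\<Sum>i\<in>-{k}. w $ i) - s' * (1 + t)"
      by (simp add: sum_subtractf s'_def sum_distrib_right)
    finally have g: "g (T3 (T4 w)) = (\<Sum>i\<in>-{k}. w $ i) - s' * (1 + t)" .
    have \<xi>: "\<xi> $ i = (if i = k then (t + g (T3 (T4 w))) / x $ k else 1 + t - w $ i / x $ i)" for i
      by (simp add: \<xi>_def T1_def T2_def T3 c_def axis_def)
    have "(\<Sum>i\<in>-{k}. \<xi> $ i * x $ i) = - g (T3 (T4 w))"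
      unfolding g_def sum_negf[symmetric]
      by (intro sum.cong) (auto simp: \<xi> T3 algebra_simps)
    then have ip: "\<xi> \<bullet> x = t"
      using pos[of k] by (simp add: inner_vec_def split \<xi>)
    have 0: "0 \<le> 1 + \<xi> \<bullet> x \<longleftrightarrow> 0 \<le> w $ k"
      using s by (simp add: ip t_def zero_le_divide_iff)
    have 1: "\<xi> $ i \<le> 1 + \<xi> \<bullet> x \<longleftrightarrow> 0 \<le> w $ i" if "i \<noteq> k" for i
      using that pos[of i] by (simp add: ip \<xi> zero_le_divide_iff)
    have "\<xi> $ k \<le> 1 + \<xi> \<bullet> x \<longleftrightarrow> t + g (T3 (T4 w)) \<le> x $ k * (1 + t)"
      using pos[of k] by (simp add: ip \<xi> pos_divide_le_eq mult.commute)
    also have "\<dots> \<longleftrightarrow> (\<Sum>i\<in>-{k}. w $ i) + (1 - s) * (1 + t) \<le> 1"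
      unfolding g s(1) by (simp add: algebra_simps)
    also have "(1 - s) * (1 + t) = w $ k" using s by (simp add: t_def)
    finally have 2: "\<xi> $ k \<le> 1 + \<xi> \<bullet> x \<longleftrightarrow> (\<Sum>i\<in>UNIV. w $ i) \<le> 1"
      by (simp add: split add.commute)
    have "\<xi> \<in> polar_at std_simplex x \<longleftrightarrow> w \<in> std_simplex"
      unfolding polar_at_std_simplex unfolding std_simplex_vec mem_Collect_eq using 0 1 2 by metis
    then show "?P (T1 (T2 (T3 (T4 w)))) = indicator std_simplex w"
      by (simp add: \<xi>_def indicator_def)
  qed
  also have "\<dots> = ennreal (1 / fact CARD('n))"
  proof -
    have "std_simplex \<in> sets (borel :: (real ^ 'n) measure)"
      unfolding std_simplex_def by (intro borel_compact finite_imp_compact_convex_hull) simp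
    then show ?thesis
      using emeasure_std_simplex[where ?'a = "real ^ 'n"] by (simp add: std_simplex_def)
  qed
  also have "(\<Prod>i\<in>UNIV. \<bar>c $ i\<bar>) = 1 / x $ k"
    using pos[of k] by (simp add: psplit c_def)
  also have "(\<Prod>i\<in>UNIV. \<bar>d $ i\<bar>) = 1 / (1 - s) * (1 / p)"
    using s pos by (simp add: psplit d_def p_def prod_dividef less_imp_le)
  finally show ?thesis
    using s p pos[of k] by (simp add: psplit p_def[symmetric] s_def[symmetric] ennreal_mult'[symmetric] mult_ac)
qed

section \<open>Forward balls of the simplex\<close>

text \<open>
  The contraction towards the barycenter with factor \<open>1 - e\<^sup>-\<^sup>R\<close> acts affinely on each barycentric
  coordinate and fixes the value \<open>1 / (n + 1)\<close>, so the bound \<open>0\<close> becomes \<open>e\<^sup>-\<^sup>R / (n + 1)\<close>.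
\<close>

lemma simplex_ball_eq:
  assumes R: "R > 0"
  shows "(simplex_ball R :: (real ^ 'n) set) =
    {x. (\<forall>i. exp (- R) / (real CARD('n) + 1) \<le> x $ i) \<and> (\<Sum>i\<in>UNIV. x $ i) \<le> 1 - exp (- R) / (real CARD('n) + 1)}"
    (is "_ = {x. (\<forall>i. ?a \<le> x $ i) \<and> _}")
proof -
  define N where "N = real CARD('n)"
  define c where "c = 1 - exp (- R)"
  have c: "c > 0" using R by (simp add: c_def)
  define b where "b = (simplex_barycenter :: real ^ 'n)"
  have bi: "b $ i = 1 / (N + 1)" for i by (simp add: b_def simplex_barycenter_def N_def)
  have N: "N + 1 > 0" by (simp add: N_def)
  have ac: "?a = (1 - c) / (N + 1)" by (simp add: c_def N_def)
  have sumb: "(\<Sum>i\<in>UNIV. b $ i) = N / (N + 1)" by (simp add: bi N_def)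
  have "x \<in> simplex_ball R \<longleftrightarrow> b + (1 / c) *\<^sub>R (x - b) \<in> std_simplex" for x
  proof
    assume "x \<in> simplex_ball R"
    then show "b + (1 / c) *\<^sub>R (x - b) \<in> std_simplex"
      using c by (auto simp: simplex_ball_def funk_ball_def b_def[symmetric] c_def[symmetric])
  next
    assume "b + (1 / c) *\<^sub>R (x - b) \<in> std_simplex"
    moreover have "x = b + c *\<^sub>R ((b + (1 / c) *\<^sub>R (x - b)) - b)" using c by simp
    ultimately show "x \<in> simplex_ball R"
      unfolding simplex_ball_def funk_ball_def b_def[symmetric] c_def[symmetric] by blast
  qed
  moreover have "0 \<le> (b + (1 / c) *\<^sub>R (x - b)) $ i \<longleftrightarrow> ?a \<le> x $ i" for x i
  proof -
    have "(b + (1 / c) *\<^sub>R (x - b)) $ i = (x $ i - (1 - c) * b $ i) / c"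
      using c by (simp add: field_simps)
    then show ?thesis unfolding ac using c by (simp add: bi zero_le_divide_iff)
  qed
  moreover have "(\<Sum>i\<in>UNIV. (b + (1 / c) *\<^sub>R (x - b)) $ i) \<le> 1 \<longleftrightarrow> (\<Sum>i\<in>UNIV. x $ i) \<le> 1 - ?a" for x
  proof -
    have "(\<Sum>i\<in>UNIV. (b + (1 / c) *\<^sub>R (x - b)) $ i) = N / (N + 1) + ((\<Sum>i\<in>UNIV. x $ i) - N / (N + 1)) / c"
      by (simp add: sum.distrib sumb sum_subtractf flip: sum_divide_distrib)
    also have "\<dots> \<le> 1 \<longleftrightarrow> (\<Sum>i\<in>UNIV. x $ i) \<le> c + (1 - c) * (N / (N + 1))"
    proof -
      have "\<sigma> + (Y - \<sigma>) / c \<le> 1 \<longleftrightarrow> Y \<le> c + (1 - c) * \<sigma>" for \<sigma> Y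
        using c by (simp add: field_simps)
      then show ?thesis .
    qed
    also have "c + (1 - c) * (N / (N + 1)) = 1 - ?a"
      unfolding ac using N by (simp add: field_simps)
    finally show ?thesis .
  qed
  ultimately show ?thesis by (auto simp: std_simplex_vec)
qed

text \<open>
  The weight \<open>\<phi>\<close> of the coordinate sum is \<open>1\<close> for \<open>V\<close>, and \<open>w \<mapsto> 1 / (n! (1 - w))\<close> for the
  Holmes--Thompson volume.
\<close>

lemma nn_integral_simplex_ball:
  fixes \<phi> :: "real \<Rightarrow> ennreal"
  assumes R: "R > 0" and \<phi>[measurable]: "\<phi> \<in> borel_measurable borel"
  defines "a \<equiv> exp (- R) / (real CARD('n) + 1)"
  shows "(\<integral>\<^sup>+x\<in>(simplex_ball R :: (real ^ 'n) set). \<phi> (\<Sum>i\<in>UNIV. x $ i) * ennreal (1 / (\<Prod>i\<in>UNIV. x $ i)) \<partial>lborel)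
    = (\<integral>\<^sup>+z. \<phi> (\<Sum>b\<in>Basis. z b) * (ennreal (\<Prod>b\<in>Basis. trunc_recip a (z b)) * indicator {..1 - a} (\<Sum>b\<in>Basis. z b))
         \<partial>(\<Pi>\<^sub>M b\<in>(Basis :: (real ^ 'n) set). lborel))"
proof -
  have "(\<integral>\<^sup>+x\<in>(simplex_ball R :: (real ^ 'n) set). \<phi> (\<Sum>i\<in>UNIV. x $ i) * ennreal (1 / (\<Prod>i\<in>UNIV. x $ i)) \<partial>lborel)
    = (\<integral>\<^sup>+x. \<phi> (\<Sum>b\<in>(Basis :: (real ^ 'n) set). x \<bullet> b) * (ennreal (\<Prod>b\<in>Basis. trunc_recip a (x \<bullet> b)) * indicator {..1 - a} (\<Sum>b\<in>Basis. x \<bullet> b)) \<partial>lborel)"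
  proof (rule nn_integral_cong)
    fix x :: "real ^ 'n"
    show "\<phi> (\<Sum>i\<in>UNIV. x $ i) * ennreal (1 / (\<Prod>i\<in>UNIV. x $ i)) * indicator (simplex_ball R) x
      = \<phi> (\<Sum>b\<in>Basis. x \<bullet> b) * (ennreal (\<Prod>b\<in>Basis. trunc_recip a (x \<bullet> b)) * indicator {..1 - a} (\<Sum>b\<in>Basis. x \<bullet> b))"
    proof (cases "\<forall>i. a \<le> x $ i")
      case True
      have P: "(\<Prod>b\<in>Basis. trunc_recip a (x \<bullet> b)) = (\<Prod>i\<in>UNIV. 1 / x $ i)"
        unfolding prod_Basis_vec[where f = "trunc_recip a"] using True by (simp add: trunc_recip_def)
      from True show ?thesis
        by (simp add: sum_Basis_vec[where f = "\<lambda>x. x"] P prod_dividef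
            simplex_ball_eq[OF R] a_def[symmetric] indicator_def)
    next
      case False
      then obtain i where "x $ i < a" by (auto simp: not_le)
      then have P: "(\<Prod>b\<in>Basis. trunc_recip a (x \<bullet> b)) = 0"
        unfolding prod_Basis_vec[where f = "trunc_recip a"] by (intro prod_trunc_recip_eq_0) auto
      then show ?thesis using False
        by (simp add: P simplex_ball_eq[OF R] a_def[symmetric])
    qed
  qed
  also have "\<dots> = (\<integral>\<^sup>+z. \<phi> (\<Sum>b\<in>Basis. z b) * (ennreal (\<Prod>b\<in>Basis. trunc_recip a (z b)) * indicator {..1 - a} (\<Sum>b\<in>Basis. z b))
         \<partial>(\<Pi>\<^sub>M b\<in>(Basis :: (real ^ 'n) set). lborel))"
    by (subst nn_integral_lborel_PiM_Basis) (simp_all add: inner_sum_left_Basis cong: sum.cong prod.cong)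
  finally show ?thesis .
qed

text \<open>
  The data of the truncated simplex for the truncation level \<open>a = e\<^sup>-\<^sup>R / (n + 1)\<close>: it is nonempty,
  and its scale invariant size \<open>(1 - a) / a\<close> exceeds the end point \<open>n\<close> of the domain of
  \<open>cut_fun n\<close>, in the interior of which \<open>cut_fun n\<close> is differentiable.
\<close>

lemma simplex_ball_cut:
  fixes n :: nat
  assumes "R > 0"
  shows "(exp (- R) / (real n + 1)) * real n \<le> 1 - exp (- R) / (real n + 1)"
    and "(1 - exp (- R) / (real n + 1)) / (exp (- R) / (real n + 1)) = (real n + 1) * exp R - 1"
    and "real n < (real n + 1) * exp R - 1"
proof -
  have "exp (- R) \<le> 1" using assms by simp
  moreover have "(exp (- R) / (real n + 1)) * (real n + 1) = exp (- R)"
    by (simp add: add_pos_nonneg)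
  ultimately show "(exp (- R) / (real n + 1)) * real n \<le> 1 - exp (- R) / (real n + 1)"
    by (simp only: distrib_left mult_1_right)
  show "(1 - exp (- R) / (real n + 1)) / (exp (- R) / (real n + 1)) = (real n + 1) * exp R - 1"
  proof -
    have "(1 - 1 / q) / (1 / q) = q - 1" if "q > 0" for q :: real
      using that by (simp add: field_simps)
    from this[of "(real n + 1) * exp R"] show ?thesis
      by (simp add: exp_minus add_pos_nonneg inverse_eq_divide mult.commute)
  qed
  have "(real n + 1) * 1 < (real n + 1) * exp R"
    by (rule mult_strict_left_mono) (use assms in auto)
  then show "real n < (real n + 1) * exp R - 1" by (simp only: mult_1_right less_diff_eq)
qed

lemma cut_integral_simplex:
  assumes "R > 0"
  shows "cut_integral (Basis :: (real ^ 'n) set) (exp (- R) / (real CARD('n) + 1)) (1 - exp (- R) / (real CARD('n) + 1))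
       = ennreal (cut_fun CARD('n) ((real CARD('n) + 1) * exp R - 1))"
  using simplex_ball_cut[OF assms, of "CARD('n)"]
  by (simp add: cut_integral_eq_cut_fun)

lemma simplex_V_eq_cut_fun:
  assumes R: "R > 0"
  shows "simplex_V TYPE('n::finite) R =
     (real CARD('n) + 1) / fact CARD('n) * cut_fun CARD('n) ((real CARD('n) + 1) * exp R - 1)"
proof -
  let ?U = "simplex_ball R :: (real ^ 'n) set"
  have pos: "x $ i > 0" if "x \<in> ?U" for x i
  proof -
    have "0 < exp (- R) / (real CARD('n) + 1)" by simp
    also have "\<dots> \<le> x $ i" using that by (simp add: simplex_ball_eq[OF R])
    finally show ?thesis .
  qed
  have [measurable]: "?U \<in> sets borel"
    unfolding simplex_ball_eq[OF R] by measurable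
  have "(LINT x:?U|lborel. 1 / (\<Prod>i\<in>UNIV. x $ i)) = enn2real (\<integral>\<^sup>+x. ennreal (indicator ?U x *\<^sub>R (1 / (\<Prod>i\<in>UNIV. x $ i))) \<partial>lborel)"
    unfolding set_lebesgue_integral_def
  proof (rule integral_eq_nn_integral)
    show "AE x in lborel. 0 \<le> indicator ?U x *\<^sub>R (1 / (\<Prod>i\<in>UNIV. x $ i))"
      using pos by (intro always_eventually allI) (auto simp: indicator_def less_imp_le intro!: prod_nonneg)
  qed measurable
  also have "(\<integral>\<^sup>+x. ennreal (indicator ?U x *\<^sub>R (1 / (\<Prod>i\<in>UNIV. x $ i))) \<partial>lborel)
     = (\<integral>\<^sup>+x\<in>?U. 1 * ennreal (1 / (\<Prod>i\<in>UNIV. x $ i)) \<partial>lborel)"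
    by (intro nn_integral_cong) (auto simp: indicator_def)
  also have "\<dots> = cut_integral (Basis :: (real ^ 'n) set) (exp (- R) / (real CARD('n) + 1)) (1 - exp (- R) / (real CARD('n) + 1))"
    by (subst nn_integral_simplex_ball[OF R, where \<phi> = "\<lambda>_. 1"]) (simp_all add: cut_integral_def)
  also have "\<dots> = ennreal (cut_fun CARD('n) ((real CARD('n) + 1) * exp R - 1))"
    by (rule cut_integral_simplex[OF R])
  also have "enn2real \<dots> = cut_fun CARD('n) ((real CARD('n) + 1) * exp R - 1)"
    using simplex_ball_cut(3)[OF R, of "CARD('n)"] by (intro enn2real_ennreal cut_fun_nonneg) simp
  finally show ?thesis by (simp add: simplex_V_def)
qed

lemma holmes_thompson_simplex_ball:
  assumes R: "R > 0"
  shows "holmes_thompson (std_simplex :: (real ^ 'n) set) (simplex_ball R)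
            = ennreal (1 / measure lborel (ball (0 :: real ^ 'n) 1) * simplex_V TYPE('n::finite) R)"
proof -
  let ?U = "simplex_ball R :: (real ^ 'n) set"
  let ?n = "CARD('n)"
  let ?v = "cut_fun CARD('n) ((real CARD('n) + 1) * exp R - 1)"
  define a where "a = exp (- R) / (real CARD('n) + 1)"
  have a: "a > 0" by (simp add: a_def add_pos_nonneg)
  have v: "?v \<ge> 0"
    using simplex_ball_cut(3)[OF R, of "CARD('n)"] by (intro cut_fun_nonneg) simp
  let ?\<phi> = "\<lambda>w. ennreal (1 / fact ?n) * ennreal (1 / (1 - w))"
  have "(\<integral>\<^sup>+x\<in>?U. emeasure lborel (polar_at std_simplex x) \<partial>lborel) =
     (\<integral>\<^sup>+x\<in>?U. ?\<phi> (\<Sum>i\<in>UNIV. x $ i) * ennreal (1 / (\<Prod>i\<in>UNIV. x $ i)) \<partial>lborel)"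
  proof (intro nn_integral_cong)
    fix x :: "real ^ 'n"
    show "emeasure lborel (polar_at std_simplex x) * indicator ?U x =
      ?\<phi> (\<Sum>i\<in>UNIV. x $ i) * ennreal (1 / (\<Prod>i\<in>UNIV. x $ i)) * indicator ?U x"
    proof (cases "x \<in> ?U")
      case True
      then have x: "a \<le> x $ i" "(\<Sum>i\<in>UNIV. x $ i) \<le> 1 - a" for i
        by (auto simp: simplex_ball_eq[OF R] a_def)
      have p: "x $ i > 0" for i using x(1)[of i] a by linarith
      have s: "(\<Sum>i\<in>UNIV. x $ i) < 1" using x(2) a by linarith
      have "(\<Prod>i\<in>UNIV. x $ i) > 0" using p by (intro prod_pos) auto
      then show ?thesis using s
        by (simp add: emeasure_polar_at_std_simplex[OF p s] ennreal_mult'[symmetric] mult_ac)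
    qed simp
  qed
  also have "\<dots> = (\<integral>\<^sup>+z. ?\<phi> (\<Sum>b\<in>Basis. z b) * (ennreal (\<Prod>b\<in>Basis. trunc_recip a (z b)) * indicator {..1 - a} (\<Sum>b\<in>Basis. z b))
         \<partial>(\<Pi>\<^sub>M b\<in>(Basis :: (real ^ 'n) set). lborel))"
    unfolding a_def by (rule nn_integral_simplex_ball[OF R]) measurable
  also have "\<dots> = ennreal (1 / fact ?n) * (\<integral>\<^sup>+z. ennreal (1 / (1 - (\<Sum>b\<in>Basis. z b))) * (ennreal (\<Prod>b\<in>Basis. trunc_recip a (z b)) * indicator {..1 - a} (\<Sum>b\<in>Basis. z b))
         \<partial>(\<Pi>\<^sub>M b\<in>(Basis :: (real ^ 'n) set). lborel))"
    by (subst nn_integral_cmult[symmetric]) (measurable, simp add: mult.assoc)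
  also have "\<dots> = ennreal (1 / fact ?n) * (of_nat (?n + 1) * cut_integral (Basis :: (real ^ 'n) set) a (1 - a))"
    by (subst nn_integral_last_coordinate[OF _ a]) simp_all
  also have "\<dots> = ennreal (1 / fact ?n) * (ennreal (real ?n + 1) * ennreal ?v)"
    unfolding a_def cut_integral_simplex[OF R] by (simp add: ennreal_of_nat_eq_real_of_nat ennreal_plus add.commute)
  also have "\<dots> = ennreal (simplex_V TYPE('n) R)"
  proof -
    have "simplex_V TYPE('n) R = 1 / fact ?n * ((real ?n + 1) * ?v)"
      by (simp add: simplex_V_eq_cut_fun[OF R])
    then show ?thesis using v by (simp only: ennreal_mult mult_nonneg_nonneg add_nonneg_nonneg
        of_nat_0_le_iff zero_le_one fact_ge_zero divide_nonneg_nonneg)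
  qed
  finally have 1: "(\<integral>\<^sup>+x\<in>?U. emeasure lborel (polar_at std_simplex x) \<partial>lborel) = ennreal (simplex_V TYPE('n) R)" .
  have V: "simplex_V TYPE('n) R \<ge> 0" using v by (simp add: simplex_V_eq_cut_fun[OF R])
  have b: "measure lborel (ball (0 :: real ^ 'n) 1) > 0"
    using content_ball_pos[of 1 "0 :: real ^ 'n"] by simp
  have "emeasure lborel (ball (0 :: real ^ 'n) 1) = ennreal (measure lborel (ball (0 :: real ^ 'n) 1))"
    by (intro emeasure_eq_ennreal_measure) (simp add: emeasure_ball)
  then show ?thesis
    unfolding holmes_thompson_def 1 by (simp add: divide_ennreal[OF V b])
qed

lemma simplex_V_derivative:
  assumes n: "n = CARD('n::finite)" "CARD('m::finite) = n - 1" "n \<ge> 2" and R: "R > 0"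
  shows "(simplex_V TYPE('n) has_real_derivative
            (real n + 1) / real n * (1 / (1 - exp (- R) / (real n + 1)))
              * simplex_V TYPE('m) (R + ln (1 + 1 / real n - 1 / real n * exp (- R)))) (at R)"
proof -
  obtain m where m: "n = Suc m" "m \<ge> 1" using n(3) by (cases n) auto
  let ?N = "real n + 1"
  let ?u = "?N * exp R - 1"
  let ?S = "R + ln (1 + 1 / real n - 1 / real n * exp (- R))"
  have e: "exp (- R) < 1" using R by simp
  have q: "1 / real n - 1 / real n * exp (- R) > 0" using e m by (simp add: field_simps)
  then have S: "?S > 0" using R by (smt (verit) ln_gt_zero)
  have "exp ?S = exp R * (1 + 1 / real n - 1 / real n * exp (- R))"
    using q by (simp add: exp_add)
  also have "\<dots> = ?u / real n"
  proof -
    have "E * (1 + 1 / r - 1 / r * (1 / E)) = ((r + 1) * E - 1) / r" if "r > 0" "E > 0" for r E :: real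
      using that by (simp add: field_simps)
    from this[of "real n" "exp R"] m show ?thesis by (simp add: exp_minus inverse_eq_divide)
  qed
  \<comment> \<open>the argument of the logarithm is chosen so that \<open>S\<close> corresponds to \<open>u - 1\<close> one dimension lower\<close>
  finally have expS: "real n * exp ?S - 1 = ?u - 1" using m by simp
  have VS: "simplex_V TYPE('m) ?S = real n / fact m * cut_fun m (?u - 1)"
  proof -
    have m': "CARD('m) = m" "real m + 1 = real n" using n(2) m by simp_all
    show ?thesis unfolding simplex_V_eq_cut_fun[OF S] m' expS ..
  qed
  have u: "?u > real (Suc m)" using simplex_ball_cut(3)[OF R, of n] m by simp
  have "((\<lambda>R. cut_fun n (?N * exp R - 1)) has_real_derivative (real (Suc m) * cut_fun m (?u - 1) / ?u) * (?N * exp R)) (at R)"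
    unfolding m(1)
    by (rule DERIV_chain2[OF cut_fun_derivative_interior])
       (use u m in \<open>auto intro!: derivative_eq_intros simp del: of_nat_Suc\<close>)
  then have "((\<lambda>R. ?N / fact n * cut_fun n (?N * exp R - 1)) has_real_derivative
      ?N / fact n * ((real (Suc m) * cut_fun m (?u - 1) / ?u) * (?N * exp R))) (at R)"
    by (rule DERIV_cmult)
  also have "?N / fact n * ((real (Suc m) * cut_fun m (?u - 1) / ?u) * (?N * exp R))
     = ?N / real n * (1 / (1 - exp (- R) / ?N)) * simplex_V TYPE('m) ?S"
  proof -
    have "1 / (1 - 1 / E / K) = K * E / (K * E - 1)" if "K > 0" "E > 0" for K E :: real
      using that by (simp add: divide_simps mult.commute)
    from this[of ?N "exp R"] have "1 / (1 - exp (- R) / ?N) = ?N * exp R / ?u"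
      by (simp add: exp_minus inverse_eq_divide)
    then show ?thesis unfolding VS unfolding m(1) by (simp add: fact_Suc mult_ac del: of_nat_Suc)
  qed
  finally show ?thesis
    by (rule has_field_derivative_transform_within_open[where S = "{0<..}"])
       (use R n in \<open>auto simp: simplex_V_eq_cut_fun\<close>)
qed

text \<open>
  Here \<open>ln (N e\<^sup>R - 1) = R + ln N + o(1)\<close>, so the \<open>n\<close>-th power of the logarithm contributes the two
  leading terms, and the error in \<open>cut_fun_at_top\<close> is of lower order.
\<close>

lemma cut_fun_exp_at_top:
  assumes "n \<ge> 1" and N: "(N::real) > 0"
  shows "((\<lambda>R. R * (cut_fun n (N * exp R - 1) / R ^ n - 1 - real n * ln N * (1 / R))) \<longlongrightarrow> 0) at_top"
proof -
  obtain m where m: "n = Suc m" using assms by (cases n) auto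
  define \<delta> where "\<delta> = (\<lambda>u. (cut_fun (Suc m) u - ln u ^ Suc m) / ln u ^ m)"
  let ?L = "\<lambda>R. ln (N * exp R - 1)"
  have 1: "((\<lambda>R. \<delta> (N * exp R - 1) * (?L R / R) ^ m) \<longlongrightarrow> 0 * 1 ^ m) at_top"
  proof (intro tendsto_intros)
    show "((\<lambda>R. \<delta> (N * exp R - 1)) \<longlongrightarrow> 0) at_top"
      by (rule filterlim_compose[OF cut_fun_at_top[of m, folded \<delta>_def]]) (use N in real_asymp)
    show "((\<lambda>R. ?L R / R) \<longlongrightarrow> 1) at_top"
      using N by real_asymp
  qed
  have 2: "((\<lambda>R. R * ((?L R / R) ^ Suc m - 1 - real (Suc m) * ln N * (1 / R))) \<longlongrightarrow> 0) at_top"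
    using N by real_asymp
  have "((\<lambda>R. \<delta> (N * exp R - 1) * (?L R / R) ^ m + R * ((?L R / R) ^ Suc m - 1 - real (Suc m) * ln N * (1 / R))) \<longlongrightarrow> 0) at_top"
    using tendsto_add[OF 1 2] by simp
  moreover have "\<forall>\<^sub>F R in at_top. ?L R > 0" "\<forall>\<^sub>F R in at_top. (R::real) > 0"
    using N by real_asymp+
  then have "\<forall>\<^sub>F R in at_top. \<delta> (N * exp R - 1) * (?L R / R) ^ m + R * ((?L R / R) ^ Suc m - 1 - real (Suc m) * ln N * (1 / R))
     = R * (cut_fun n (N * exp R - 1) / R ^ n - 1 - real n * ln N * (1 / R))"
  proof eventually_elim
    case (elim R)
    have "cut_fun n (N * exp R - 1) = \<delta> (N * exp R - 1) * ?L R ^ m + ?L R ^ Suc m"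
      using elim by (simp add: \<delta>_def m del: cut_fun.simps)
    moreover have "d * (L / R) ^ m = R * (d * L ^ m / R ^ Suc m)" for d L
      using elim by (simp add: power_divide)
    ultimately show ?case
      by (simp add: m add_divide_distrib power_divide distrib_left right_diff_distrib del: cut_fun.simps power_Suc of_nat_Suc)
  qed
  ultimately show ?thesis by (simp add: tendsto_cong)
qed

text \<open>
  With \<open>h = (n + 1) (e\<^sup>R - 1)\<close> and \<open>e\<^sup>R - 1 = R + R\<^sup>2 / 2 + \<dots>\<close>, the power \<open>h\<^sup>n\<close> contributes \<open>n / 2\<close> to the relative
  coefficient of \<open>R\<^sup>n\<^sup>+\<^sup>1\<close> and the second term of \<open>cut_fun_at_right\<close> contributes \<open>- n\<close>.
\<close>

lemma cut_fun_exp_at_right: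
  "((\<lambda>R. (fact n / (real n + 1) ^ n * cut_fun n ((real n + 1) * exp R - 1) - (R ^ n - real n / 2 * R ^ (n + 1))) / R ^ (n + 1)) \<longlongrightarrow> 0) (at_right 0)"
proof -
  define N where "N = real n + 1"
  have N: "N > 0" by (simp add: N_def)
  define \<delta> where "\<delta> = (\<lambda>h. (cut_fun n (real n + h) - (h ^ n / fact n - real n / fact (Suc n) * h ^ Suc n)) / h ^ Suc n)"
  let ?h = "\<lambda>R. N * (exp R - 1)"
  let ?q = "\<lambda>R::real. (exp R - 1) / R"
  have q: "(?q \<longlongrightarrow> 1) (at_right 0)" by real_asymp
  have d: "((\<lambda>R. \<delta> (?h R)) \<longlongrightarrow> 0) (at_right 0)"
    by (rule filterlim_compose[OF cut_fun_at_right[of n, folded \<delta>_def]]) (use N in real_asymp)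
  have p: "((\<lambda>R. (?q R ^ n - 1) / R) \<longlongrightarrow> real n / 2) (at_right 0)"
    by real_asymp
  let ?E = "\<lambda>R. (fact n * N * \<delta> (?h R) - real n) * ?q R ^ Suc n + (?q R ^ n - 1) / R + real n / 2"
  have "(?E \<longlongrightarrow> (fact n * N * 0 - real n) * 1 ^ Suc n + real n / 2 + real n / 2) (at_right 0)"
    by (intro tendsto_intros q d p)
  then have "(?E \<longlongrightarrow> 0) (at_right 0)" by simp
  moreover have "\<forall>\<^sub>F R in at_right 0. (R::real) > 0" by (simp add: eventually_at_right_less)
  then have "\<forall>\<^sub>F R in at_right 0. ?E R = (fact n / N ^ n * cut_fun n (N * exp R - 1) - (R ^ n - real n / 2 * R ^ (n + 1))) / R ^ (n + 1)"
  proof eventually_elim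
    case (elim R)
    define E where "E = exp R - 1"
    have E: "E > 0" using elim by (simp add: E_def)
    have "cut_fun n (N * exp R - 1) = cut_fun n (real n + N * E)"
      by (simp add: N_def E_def algebra_simps)
    also have "\<dots> = \<delta> (N * E) * (N * E) ^ Suc n + ((N * E) ^ n / fact n - real n / (N * fact n) * (N * E) ^ Suc n)"
      using N E by (simp add: \<delta>_def N_def add.commute)
    finally have "fact n / N ^ n * cut_fun n (N * exp R - 1) = (fact n * N * \<delta> (N * E) - real n) * E ^ Suc n + E ^ n"
      using N by (simp add: power_mult_distrib field_simps)
    moreover have "(A * (E ^ Suc n) + E ^ n - (R ^ n - real n / 2 * R ^ (n + 1))) / R ^ (n + 1) =
       A * (E / R) ^ Suc n + ((E / R) ^ n - 1) / R + real n / 2" for A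
      using elim by (simp add: power_divide field_simps)
    ultimately show ?case by (simp add: E_def)
  qed
  ultimately show ?thesis by (simp add: tendsto_cong N_def)
qed

theorem theorem9p1:
  fixes n :: nat
  assumes "n = CARD('n::finite)"
  shows "(\<forall>R>0. holmes_thompson (std_simplex :: (real ^ 'n) set) (simplex_ball R)
            = ennreal (1 / measure lborel (ball (0 :: real ^ 'n) 1) * simplex_V TYPE('n) R))
    \<and> (n \<ge> 2 \<longrightarrow> CARD('m::finite) = n - 1 \<longrightarrow>
        (\<forall>R>0. (simplex_V TYPE('n) has_real_derivative
            (real n + 1) / real n * (1 / (1 - exp (- R) / (real n + 1)))
              * simplex_V TYPE('m) (R + ln (1 + 1 / real n - 1 / real n * exp (- R)))) (at R)))
    \<and> (\<exists>\<epsilon> \<in> o[at_top](\<lambda>R. 1 / R). \<forall>R>0. simplex_V TYPE('n) R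
          = fact (n + 1) / (fact n)\<^sup>2 * R ^ n * (1 + real n * ln (real n + 1) * (1 / R) + \<epsilon> R))
    \<and> (\<exists>\<epsilon> \<in> o[at_right 0](\<lambda>R. R ^ (n + 1)). \<forall>R>0. simplex_V TYPE('n) R
          = (real n + 1) ^ (n + 1) / (fact n)\<^sup>2 * (R ^ n - real n / 2 * R ^ (n + 1) + \<epsilon> R))"
proof (intro conjI impI allI)
  have n: "n \<ge> 1" using assms by (simp add: Suc_leI)
  have V: "simplex_V TYPE('n) R = (real n + 1) / fact n * cut_fun n ((real n + 1) * exp R - 1)" if "R > 0" for R
    using simplex_V_eq_cut_fun[OF that, where ?'n = 'n] assms by simp
  show "holmes_thompson (std_simplex :: (real ^ 'n) set) (simplex_ball R)
            = ennreal (1 / measure lborel (ball (0 :: real ^ 'n) 1) * simplex_V TYPE('n) R)" if "R > 0" for R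
    by (rule holmes_thompson_simplex_ball[OF that])
  show "(simplex_V TYPE('n) has_real_derivative
            (real n + 1) / real n * (1 / (1 - exp (- R) / (real n + 1)))
              * simplex_V TYPE('m) (R + ln (1 + 1 / real n - 1 / real n * exp (- R)))) (at R)"
    if "n \<ge> 2" "CARD('m) = n - 1" "R > 0" for R
    by (rule simplex_V_derivative[OF assms that(2,1,3)])
  show "\<exists>\<epsilon> \<in> o[at_top](\<lambda>R. 1 / R). \<forall>R>0. simplex_V TYPE('n) R
          = fact (n + 1) / (fact n)\<^sup>2 * R ^ n * (1 + real n * ln (real n + 1) * (1 / R) + \<epsilon> R)"
  proof (intro bexI allI impI)
    let ?\<epsilon> = "\<lambda>R. cut_fun n ((real n + 1) * exp R - 1) / R ^ n - 1 - real n * ln (real n + 1) * (1 / R)"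
    show "?\<epsilon> \<in> o[at_top](\<lambda>R. 1 / R)"
    proof (rule smalloI_tendsto)
      show "((\<lambda>R. ?\<epsilon> R / (1 / R)) \<longlongrightarrow> 0) at_top"
        using cut_fun_exp_at_top[OF n, of "real n + 1"] by (simp add: mult.commute)
      show "\<forall>\<^sub>F R in at_top. 1 / R \<noteq> (0::real)"
        using eventually_gt_at_top[of 0] by eventually_elim simp
    qed
    show "simplex_V TYPE('n) R = fact (n + 1) / (fact n)\<^sup>2 * R ^ n * (1 + real n * ln (real n + 1) * (1 / R) + ?\<epsilon> R)"
      if "R > 0" for R
      unfolding V[OF that] using that by (simp add: power2_eq_square add.commute)
  qed
  show "\<exists>\<epsilon> \<in> o[at_right 0](\<lambda>R. R ^ (n + 1)). \<forall>R>0. simplex_V TYPE('n) R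
          = (real n + 1) ^ (n + 1) / (fact n)\<^sup>2 * (R ^ n - real n / 2 * R ^ (n + 1) + \<epsilon> R)"
  proof (intro bexI allI impI)
    let ?\<epsilon> = "\<lambda>R. fact n / (real n + 1) ^ n * cut_fun n ((real n + 1) * exp R - 1) - (R ^ n - real n / 2 * R ^ (n + 1))"
    show "?\<epsilon> \<in> o[at_right 0](\<lambda>R. R ^ (n + 1))"
    proof (rule smalloI_tendsto)
      show "((\<lambda>R. ?\<epsilon> R / R ^ (n + 1)) \<longlongrightarrow> 0) (at_right 0)"
        by (rule cut_fun_exp_at_right)
      show "\<forall>\<^sub>F R in at_right 0. R ^ (n + 1) \<noteq> (0::real)"
        using eventually_at_right_less[of 0] by eventually_elim simp
    qed
    show "simplex_V TYPE('n) R = (real n + 1) ^ (n + 1) / (fact n)\<^sup>2 * (R ^ n - real n / 2 * R ^ (n + 1) + ?\<epsilon> R)"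
      if "R > 0" for R
    proof -
      have "K / f * c = K ^ (n + 1) / f\<^sup>2 * (f / K ^ n * c)" if "K > 0" "f > 0" for K f c :: real
        using that by (simp add: power2_eq_square)
      from this[of "real n + 1" "fact n"] show ?thesis unfolding V[OF that] by (simp add: add.commute)
    qed
  qed
qed

end
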